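(* Let $\mathbf{P}=(P,\preceq_+,\preceq_-)$ be a compatible double poset. Then, with respect to the term order $\prec$ described in the context, a Gröbner basis of the toric ideal $I=\ker\hat\phi$ is given by the binomials \[\underline{x_{\Phi_\sigma}x_{\Phi'_\sigma}}-x_{\Phi_\sigma\cup\Phi'_\sigma}\,x_{\Phi_\sigma\cap\Phi'_\sigma}\] for incomparable (with respect to inclusion) filters $\Phi_\sigma,\Phi'_\sigma\in\mathcal{B}(P_\sigma)$ and $\sigma=\pm$, and \[\underline{x_{\Phi_+}x_{\Phi_-}}-x_{\Phi_+\setminus A}\,x_{\Phi_-\setminus A}\] for filters $\Phi_+\in\mathcal{B}(P_+)$, $\Phi_-\in\mathcal{B}(P_-)$ such that $A:=\min(\Phi_+)\cap\min(\Phi_-)\ne\emptyset$ (minima taken with respect to $\preceq_+$ and $\preceq_-$, respectively); the underlined monomials are the leading terms.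
   Context: A double poset is a finite set $P$ with two partial orders $\preceq_+,\preceq_-$; $P_\sigma=(P,\preceq_\sigma)$; compatible means $P_+,P_-$ have a common linear extension. $\mathcal{B}(P_\sigma)$ is the set of filters (up-closed subsets) of $P_\sigma$. Let $\hat R=\mathbb{C}[x_{\Phi_+},x_{\Phi_-}:\Phi_+\in\mathcal{B}(P_+),\Phi_-\in\mathcal{B}(P_-)]$, with separate variables for filters of $P_+$ and of $P_-$ (even if equal as sets). Let $\hat S=\mathbb{C}[t_+,t_-,s_a,s_a^{-1}:a\in P]$ and $\hat\phi:\hat R\to\hat S$ the ring map with $\hat\phi(x_{\Phi_+})=t_+\prod_{a\in\Phi_+}s_a$ and $\hat\phi(x_{\Phi_-})=t_-\prod_{a\in\Phi_-}s_a^{-1}$. Fix any total order $<$ on the variables such that, for $\sigma=\pm$, $x_{\Phi_\sigma}<x_{\Phi'_\sigma}$ whenever $\Phi_\sigma\subsetneq\Phi'_\sigma$, and $x_{\Phi_+}<x_{\Phi_-}$ for all $\Phi_+\in\mathcal{B}(P_+)$, $\Phi_-\in\mathcal{B}(P_-)$; let $\prec$ be the reverse lexicographic term order induced by $<$. *)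

theory Defs
  imports Complex_Main "HOL-Library.Poly_Mapping" "HOL-Library.Product_Plus" "HOL-Algebra.RingHom"
begin

section \<open>Double posets and their filters\<close>

datatype sign = Plus | Minus

definition double_poset :: "'a set \<Rightarrow> (sign \<Rightarrow> 'a rel) \<Rightarrow> bool" where
  "double_poset P ple \<longleftrightarrow> finite P \<and> (\<forall>\<sigma>. partial_order_on P (ple \<sigma>))"

definition compatible :: "'a set \<Rightarrow> (sign \<Rightarrow> 'a rel) \<Rightarrow> bool" where
  "compatible P ple \<longleftrightarrow> (\<exists>l. linear_order_on P l \<and> ple Plus \<subseteq> l \<and> ple Minus \<subseteq> l)"

definition poset_filters :: "'a set \<Rightarrow> 'a rel \<Rightarrow> 'a set set" where
  "poset_filters P r = {F. F \<subseteq> P \<and> (\<forall>x\<in>F. \<forall>y\<in>P. (x, y) \<in> r \<longrightarrow> y \<in> F)}"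

definition minimal_elements :: "'a rel \<Rightarrow> 'a set \<Rightarrow> 'a set" where
  "minimal_elements r F = {x \<in> F. \<forall>y\<in>F. (y, x) \<in> r \<longrightarrow> y = x}"


section \<open>Polynomial rings\<close>

text \<open>
  A monomial is its exponent vector, of type \<^typ>\<open>'v \<Rightarrow>\<^sub>0 nat\<close>; multiplication on
  \<^typ>\<open>('v \<Rightarrow>\<^sub>0 nat) \<Rightarrow>\<^sub>0 complex\<close> is convolution.
\<close>

type_synonym 'v mpoly = "('v \<Rightarrow>\<^sub>0 nat) \<Rightarrow>\<^sub>0 complex"

definition X :: "'v \<Rightarrow> 'v mpoly" where
  "X v = Poly_Mapping.single (Poly_Mapping.single v 1) 1"

definition poly_ring :: "'v set \<Rightarrow> 'v mpoly ring" where
  "poly_ring V = \<lparr>carrier = {p. \<forall>m\<in>Poly_Mapping.keys p. Poly_Mapping.keys m \<subseteq> V},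
                  monoid.mult = (*), one = 1, zero = 0, add = (+)\<rparr>"

text \<open>
  The monomials of \<open>\<complex>[t\<^sub>+, t\<^sub>-, s\<^sub>a, s\<^sub>a\<^sup>-\<^sup>1 : a \<in> P]\<close> have natural exponents in
  \<open>t\<^sub>+, t\<^sub>-\<close> and integer exponents in the \<open>s\<^sub>a\<close>.
\<close>

type_synonym 'a laurent = "((sign \<Rightarrow>\<^sub>0 nat) \<times> ('a \<Rightarrow>\<^sub>0 int)) \<Rightarrow>\<^sub>0 complex"

definition t_var :: "sign \<Rightarrow> 'a laurent" where
  "t_var \<sigma> = Poly_Mapping.single (Poly_Mapping.single \<sigma> 1, 0) 1"

definition s_var :: "'a \<Rightarrow> 'a laurent" where
  "s_var a = Poly_Mapping.single (0, Poly_Mapping.single a 1) 1"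

definition s_inv :: "'a \<Rightarrow> 'a laurent" where
  "s_inv a = Poly_Mapping.single (0, Poly_Mapping.single a (-1)) 1"

definition laurent_ring :: "'a set \<Rightarrow> 'a laurent ring" where
  "laurent_ring P = \<lparr>carrier = {p. \<forall>m\<in>Poly_Mapping.keys p. Poly_Mapping.keys (snd m) \<subseteq> P},
                     monoid.mult = (*), one = 1, zero = 0, add = (+)\<rparr>"


section \<open>The toric ideal\<close>

text \<open>The variable \<open>x\<^bsub>\<Phi>\<^sub>\<sigma>\<^esub>\<close> is indexed by the pair \<open>(\<sigma>, \<Phi>\<^sub>\<sigma>)\<close>.\<close>

type_synonym 'a filter_var = "sign \<times> 'a set"

definition filter_vars :: "'a set \<Rightarrow> (sign \<Rightarrow> 'a rel) \<Rightarrow> 'a filter_var set" where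
  "filter_vars P ple = (SIGMA \<sigma>:UNIV. poset_filters P (ple \<sigma>))"

fun phi_var :: "'a filter_var \<Rightarrow> 'a laurent" where
  "phi_var (Plus, F) = t_var Plus * (\<Prod>a\<in>F. s_var a)"
| "phi_var (Minus, F) = t_var Minus * (\<Prod>a\<in>F. s_inv a)"

definition phi_hat :: "'a filter_var mpoly \<Rightarrow> 'a laurent" where
  "phi_hat p = (\<Sum>m\<in>Poly_Mapping.keys p.
     Poly_Mapping.single 0 (Poly_Mapping.lookup p m) *
     (\<Prod>v\<in>Poly_Mapping.keys m. phi_var v ^ Poly_Mapping.lookup m v))"

definition toric_ideal :: "'a set \<Rightarrow> (sign \<Rightarrow> 'a rel) \<Rightarrow> 'a filter_var mpoly set" where
  "toric_ideal P ple = a_kernel (poly_ring (filter_vars P ple)) (laurent_ring P) phi_hat"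


section \<open>Reverse lexicographic order and Groebner bases\<close>

definition mdeg :: "('v \<Rightarrow>\<^sub>0 nat) \<Rightarrow> nat" where
  "mdeg m = (\<Sum>v\<in>Poly_Mapping.keys m. Poly_Mapping.lookup m v)"

text \<open>
  \<open>L\<close> is the reflexive form of the total order on the variables. The comparison of total
  degrees comes first, since otherwise 1 would not be the smallest monomial.
\<close>

definition revlex_less :: "'v rel \<Rightarrow> ('v \<Rightarrow>\<^sub>0 nat) \<Rightarrow> ('v \<Rightarrow>\<^sub>0 nat) \<Rightarrow> bool" where
  "revlex_less L m n \<longleftrightarrow> mdeg m < mdeg n \<or>
     (mdeg m = mdeg n \<and>
      (\<exists>v. Poly_Mapping.lookup m v > Poly_Mapping.lookup n v \<and>
         (\<forall>u. (u, v) \<in> L \<and> u \<noteq> v \<longrightarrow> Poly_Mapping.lookup m u = Poly_Mapping.lookup n u)))"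

definition leading_monomial :: "'v rel \<Rightarrow> 'v mpoly \<Rightarrow> ('v \<Rightarrow>\<^sub>0 nat)" where
  "leading_monomial L p =
     (THE m. m \<in> Poly_Mapping.keys p \<and> (\<forall>n\<in>Poly_Mapping.keys p. n \<noteq> m \<longrightarrow> revlex_less L n m))"

definition leading_term :: "'v rel \<Rightarrow> 'v mpoly \<Rightarrow> 'v mpoly" where
  "leading_term L p =
     Poly_Mapping.single (leading_monomial L p) (Poly_Mapping.lookup p (leading_monomial L p))"

definition groebner_basis :: "'v set \<Rightarrow> 'v rel \<Rightarrow> 'v mpoly set \<Rightarrow> 'v mpoly set \<Rightarrow> bool" where
  "groebner_basis V L I G \<longleftrightarrow> finite G \<and> G \<subseteq> I \<and>
     Idl\<^bsub>poly_ring V\<^esub> (leading_term L ` (I - {0})) = Idl\<^bsub>poly_ring V\<^esub> (leading_term L ` (G - {0}))"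

definition admissible_order :: "'a set \<Rightarrow> (sign \<Rightarrow> 'a rel) \<Rightarrow> 'a filter_var rel \<Rightarrow> bool" where
  "admissible_order P ple L \<longleftrightarrow> linear_order_on (filter_vars P ple) L \<and>
     (\<forall>\<sigma>. \<forall>F\<in>poset_filters P (ple \<sigma>). \<forall>F'\<in>poset_filters P (ple \<sigma>).
        F \<subset> F' \<longrightarrow> ((\<sigma>, F), (\<sigma>, F')) \<in> L) \<and>
     (\<forall>F\<in>poset_filters P (ple Plus). \<forall>F'\<in>poset_filters P (ple Minus).
        ((Plus, F), (Minus, F')) \<in> L)"


section \<open>The binomials\<close>

definition same_sign_binomials :: "'a set \<Rightarrow> (sign \<Rightarrow> 'a rel) \<Rightarrow> 'a filter_var mpoly set" where
  "same_sign_binomials P ple =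
     {X (\<sigma>, F) * X (\<sigma>, F') - X (\<sigma>, F \<union> F') * X (\<sigma>, F \<inter> F') | \<sigma> F F'.
        F \<in> poset_filters P (ple \<sigma>) \<and> F' \<in> poset_filters P (ple \<sigma>) \<and> \<not> F \<subseteq> F' \<and> \<not> F' \<subseteq> F}"

definition mixed_sign_binomials :: "'a set \<Rightarrow> (sign \<Rightarrow> 'a rel) \<Rightarrow> 'a filter_var mpoly set" where
  "mixed_sign_binomials P ple =
     {X (Plus, F) * X (Minus, F') - X (Plus, F - A) * X (Minus, F' - A) | F F' A.
        F \<in> poset_filters P (ple Plus) \<and> F' \<in> poset_filters P (ple Minus) \<and>
        A = minimal_elements (ple Plus) F \<inter> minimal_elements (ple Minus) F' \<and> A \<noteq> {}}"


section \<open>The rings and the map are as intended\<close>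

lemma poly_ring_simps [simp]:
  "carrier (poly_ring V) = {p. \<forall>m\<in>Poly_Mapping.keys p. Poly_Mapping.keys m \<subseteq> V}"
  "x \<otimes>\<^bsub>poly_ring V\<^esub> y = x * y" "x \<oplus>\<^bsub>poly_ring V\<^esub> y = x + y"
  "\<one>\<^bsub>poly_ring V\<^esub> = 1" "\<zero>\<^bsub>poly_ring V\<^esub> = 0"
  by (simp_all add: poly_ring_def)

lemma laurent_ring_simps [simp]:
  "carrier (laurent_ring P) = {p. \<forall>m\<in>Poly_Mapping.keys p. Poly_Mapping.keys (snd m) \<subseteq> P}"
  "x \<otimes>\<^bsub>laurent_ring P\<^esub> y = x * y" "x \<oplus>\<^bsub>laurent_ring P\<^esub> y = x + y"
  "\<one>\<^bsub>laurent_ring P\<^esub> = 1" "\<zero>\<^bsub>laurent_ring P\<^esub> = 0"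
  by (simp_all add: laurent_ring_def)

lemma poly_ring_mult_closed:
  fixes p q :: "'v mpoly"
  assumes "\<forall>m\<in>Poly_Mapping.keys p. Poly_Mapping.keys m \<subseteq> V" "\<forall>m\<in>Poly_Mapping.keys q. Poly_Mapping.keys m \<subseteq> V"
  shows "\<forall>m\<in>Poly_Mapping.keys (p * q). Poly_Mapping.keys m \<subseteq> V"
proof
  fix m assume "m \<in> Poly_Mapping.keys (p * q)"
  then obtain a b where "m = a + b" "a \<in> Poly_Mapping.keys p" "b \<in> Poly_Mapping.keys q"
    using Poly_Mapping.keys_mult[of p q] by blast
  then show "Poly_Mapping.keys m \<subseteq> V"
    using assms Poly_Mapping.keys_add[of a b] by blast
qed

lemma laurent_ring_mult_closed:
  fixes p q :: "'a laurent"
  assumes "\<forall>m\<in>Poly_Mapping.keys p. Poly_Mapping.keys (snd m) \<subseteq> P" "\<forall>m\<in>Poly_Mapping.keys q. Poly_Mapping.keys (snd m) \<subseteq> P"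
  shows "\<forall>m\<in>Poly_Mapping.keys (p * q). Poly_Mapping.keys (snd m) \<subseteq> P"
proof
  fix m assume "m \<in> Poly_Mapping.keys (p * q)"
  then obtain a b where "m = a + b" "a \<in> Poly_Mapping.keys p" "b \<in> Poly_Mapping.keys q"
    using Poly_Mapping.keys_mult[of p q] by blast
  moreover from this have "Poly_Mapping.keys (snd a) \<subseteq> P" "Poly_Mapping.keys (snd b) \<subseteq> P"
    using assms by blast+
  ultimately show "Poly_Mapping.keys (snd m) \<subseteq> P"
    using Poly_Mapping.keys_add[of "snd a" "snd b"] by auto
qed

lemma cring_poly_ring: "cring (poly_ring V)"
proof (rule cringI)
  show "abelian_group (poly_ring V)"
  proof (rule abelian_groupI)
    fix x y assume "x \<in> carrier (poly_ring V)" "y \<in> carrier (poly_ring V)"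
    then show "x \<oplus>\<^bsub>poly_ring V\<^esub> y \<in> carrier (poly_ring V)"
      using Poly_Mapping.keys_add[of x y] by auto
  next
    fix x assume "x \<in> carrier (poly_ring V)"
    then show "\<exists>y\<in>carrier (poly_ring V). y \<oplus>\<^bsub>poly_ring V\<^esub> x = \<zero>\<^bsub>poly_ring V\<^esub>"
      by (intro bexI[of _ "- x"]) auto
  qed (simp_all add: add.assoc add.commute)
  show "comm_monoid (poly_ring V)"
  proof (rule comm_monoidI)
    fix x y assume "x \<in> carrier (poly_ring V)" "y \<in> carrier (poly_ring V)"
    then show "x \<otimes>\<^bsub>poly_ring V\<^esub> y \<in> carrier (poly_ring V)"
      using poly_ring_mult_closed[of x V y] by simp
  qed (simp_all add: mult.assoc mult.commute)
qed (simp add: distrib_right)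

lemma cring_laurent_ring: "cring (laurent_ring P)"
proof (rule cringI)
  show "abelian_group (laurent_ring P)"
  proof (rule abelian_groupI)
    fix x y assume "x \<in> carrier (laurent_ring P)" "y \<in> carrier (laurent_ring P)"
    then show "x \<oplus>\<^bsub>laurent_ring P\<^esub> y \<in> carrier (laurent_ring P)"
      using Poly_Mapping.keys_add[of x y] by auto
  next
    fix x assume "x \<in> carrier (laurent_ring P)"
    then show "\<exists>y\<in>carrier (laurent_ring P). y \<oplus>\<^bsub>laurent_ring P\<^esub> x = \<zero>\<^bsub>laurent_ring P\<^esub>"
      by (intro bexI[of _ "- x"]) auto
  qed (simp_all add: add.assoc add.commute)
  show "comm_monoid (laurent_ring P)"
  proof (rule comm_monoidI)
    fix x y assume "x \<in> carrier (laurent_ring P)" "y \<in> carrier (laurent_ring P)"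
    then show "x \<otimes>\<^bsub>laurent_ring P\<^esub> y \<in> carrier (laurent_ring P)"
      using laurent_ring_mult_closed[of x P y] by simp
  qed (simp_all add: mult.assoc mult.commute)
qed (simp add: distrib_right)

lemma s_var_s_inv: "s_var a * s_inv a = 1"
  by (simp add: s_var_def s_inv_def mult_single flip: single_add zero_prod_def)

definition phi_mon :: "('a filter_var \<Rightarrow>\<^sub>0 nat) \<Rightarrow> 'a laurent" where
  "phi_mon m = (\<Prod>v\<in>Poly_Mapping.keys m. phi_var v ^ Poly_Mapping.lookup m v)"

lemma phi_mon_superset:
  assumes "finite A" "Poly_Mapping.keys m \<subseteq> A"
  shows "phi_mon m = (\<Prod>v\<in>A. phi_var v ^ Poly_Mapping.lookup m v)"
  unfolding phi_mon_def
  by (rule prod.mono_neutral_left) (use assms in \<open>auto simp: in_keys_iff\<close>)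

lemma phi_mon_add: "phi_mon (m + n) = phi_mon m * phi_mon n"
proof -
  let ?A = "Poly_Mapping.keys m \<union> Poly_Mapping.keys n"
  have "phi_mon (m + n) = (\<Prod>v\<in>?A. phi_var v ^ Poly_Mapping.lookup (m + n) v)"
    by (rule phi_mon_superset) (use Poly_Mapping.keys_add[of m n] in auto)
  also have "\<dots> = (\<Prod>v\<in>?A. phi_var v ^ Poly_Mapping.lookup m v) * (\<Prod>v\<in>?A. phi_var v ^ Poly_Mapping.lookup n v)"
    by (simp add: lookup_add power_add prod.distrib)
  also have "\<dots> = phi_mon m * phi_mon n"
    by (subst (1 2) phi_mon_superset[of ?A]) auto
  finally show ?thesis .
qed

lemma phi_hat_superset:
  assumes "finite A" "Poly_Mapping.keys p \<subseteq> A"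
  shows "phi_hat p = (\<Sum>m\<in>A. Poly_Mapping.single 0 (Poly_Mapping.lookup p m) * phi_mon m)"
  unfolding phi_hat_def phi_mon_def
  by (rule sum.mono_neutral_left) (use assms in \<open>auto simp: in_keys_iff\<close>)

lemma phi_hat_0 [simp]: "phi_hat 0 = 0"
  by (simp add: phi_hat_def)

lemma phi_hat_single: "phi_hat (Poly_Mapping.single m c) = Poly_Mapping.single 0 c * phi_mon m"
  by (simp add: phi_hat_def phi_mon_def)

lemma phi_hat_add: "phi_hat (p + q) = phi_hat p + phi_hat q"
proof -
  let ?A = "Poly_Mapping.keys p \<union> Poly_Mapping.keys q"
  have "phi_hat (p + q) = (\<Sum>m\<in>?A. Poly_Mapping.single 0 (Poly_Mapping.lookup (p + q) m) * phi_mon m)"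
    by (rule phi_hat_superset) (use Poly_Mapping.keys_add[of p q] in auto)
  also have "\<dots> = (\<Sum>m\<in>?A. Poly_Mapping.single 0 (Poly_Mapping.lookup p m) * phi_mon m) +
                   (\<Sum>m\<in>?A. Poly_Mapping.single 0 (Poly_Mapping.lookup q m) * phi_mon m)"
    by (simp add: lookup_add single_add distrib_right sum.distrib)
  also have "\<dots> = phi_hat p + phi_hat q"
    by (subst (1 2) phi_hat_superset[of ?A]) auto
  finally show ?thesis .
qed

lemma phi_hat_sum: "phi_hat (sum f A) = (\<Sum>x\<in>A. phi_hat (f x))"
  by (induction A rule: infinite_finite_induct) (auto simp: phi_hat_add)

lemma sum_singles: "(\<Sum>m\<in>Poly_Mapping.keys p. Poly_Mapping.single m (Poly_Mapping.lookup p m)) = p"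
  by (rule poly_mapping_eqI) (auto simp: lookup_sum lookup_single when_def in_keys_iff)

lemma phi_hat_mult: "phi_hat (p * q) = phi_hat p * phi_hat q"
proof -
  let ?s = "\<lambda>p m. Poly_Mapping.single m (Poly_Mapping.lookup p m)"
  have s: "phi_hat (?s p m * ?s q n) = phi_hat (?s p m) * phi_hat (?s q n)" for m n
  proof -
    have "Poly_Mapping.single 0 (Poly_Mapping.lookup p m * Poly_Mapping.lookup q n) =
        (Poly_Mapping.single 0 (Poly_Mapping.lookup p m) * Poly_Mapping.single 0 (Poly_Mapping.lookup q n) :: 'a laurent)"
      by (simp add: mult_single)
    then show ?thesis
      by (simp add: mult_single phi_hat_single phi_mon_add ac_simps)
  qed
  have "p * q = (\<Sum>m\<in>Poly_Mapping.keys p. ?s p m) * (\<Sum>n\<in>Poly_Mapping.keys q. ?s q n)"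
    by (simp only: sum_singles)
  also have "phi_hat \<dots> = phi_hat (\<Sum>m\<in>Poly_Mapping.keys p. ?s p m) * phi_hat (\<Sum>n\<in>Poly_Mapping.keys q. ?s q n)"
    by (simp add: sum_product phi_hat_sum s)
  finally show ?thesis
    by (simp only: sum_singles)
qed

lemma phi_hat_1 [simp]: "phi_hat 1 = 1"
  using phi_hat_single[of 0 1] by (simp add: phi_mon_def)

lemma phi_hat_X: "phi_hat (X v) = phi_var v"
  by (simp add: X_def phi_hat_single phi_mon_def)

lemma laurent_carrier_prod:
  "(\<And>x. x \<in> A \<Longrightarrow> f x \<in> carrier (laurent_ring P)) \<Longrightarrow> prod f A \<in> carrier (laurent_ring P)"
proof (induction A rule: infinite_finite_induct)
  case (insert x A)
  then have "f x \<in> carrier (laurent_ring P)" "prod f A \<in> carrier (laurent_ring P)" by auto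
  then show ?case using insert(1,2) laurent_ring_mult_closed[of "f x" P "prod f A"] by simp
qed auto

lemma phi_var_closed:
  assumes "F \<subseteq> P"
  shows "phi_var (\<sigma>, F) \<in> carrier (laurent_ring P)"
proof -
  have "(\<Prod>a\<in>F. s_var a) \<in> carrier (laurent_ring P)" "(\<Prod>a\<in>F. s_inv a) \<in> carrier (laurent_ring P)"
    by (rule laurent_carrier_prod; use assms in \<open>auto simp: s_var_def s_inv_def\<close>)+
  moreover have "t_var \<sigma> \<in> carrier (laurent_ring P)" for \<sigma>
    by (simp add: t_var_def)
  ultimately show ?thesis
    using laurent_ring_mult_closed[of "t_var \<sigma>" P] by (cases \<sigma>) auto
qed

lemma phi_hat_ring_hom: "phi_hat \<in> ring_hom (poly_ring (filter_vars P ple)) (laurent_ring P)"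
proof (rule ring_hom_memI)
  interpret S: cring "laurent_ring P" by (rule cring_laurent_ring)
  fix p :: "'a filter_var mpoly" assume p: "p \<in> carrier (poly_ring (filter_vars P ple))"
  have pw: "x ^ n \<in> carrier (laurent_ring P)" if "x \<in> carrier (laurent_ring P)" for x and n :: nat
    using that laurent_carrier_prod[of "{..<n}" "\<lambda>_. x" P] by simp
  have "phi_mon m \<in> carrier (laurent_ring P)" if "m \<in> Poly_Mapping.keys p" for m
    unfolding phi_mon_def
  proof (rule laurent_carrier_prod)
    fix v assume "v \<in> Poly_Mapping.keys m"
    then have "v \<in> filter_vars P ple" using p that by auto
    then have "phi_var v \<in> carrier (laurent_ring P)"
      by (cases v) (auto simp only: filter_vars_def poset_filters_def mem_Sigma_iff mem_Collect_eq
          intro!: phi_var_closed)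
    then show "phi_var v ^ Poly_Mapping.lookup m v \<in> carrier (laurent_ring P)" by (rule pw)
  qed
  then have *: "Poly_Mapping.single 0 (Poly_Mapping.lookup p m) * phi_mon m \<in> carrier (laurent_ring P)"
    if "m \<in> Poly_Mapping.keys p" for m
    using S.m_closed[of "Poly_Mapping.single 0 (Poly_Mapping.lookup p m)" "phi_mon m"] that
    by (simp only: laurent_ring_simps(2)) simp
  have "(\<Sum>m\<in>A. Poly_Mapping.single 0 (Poly_Mapping.lookup p m) * phi_mon m) \<in> carrier (laurent_ring P)"
    if "finite A" "A \<subseteq> Poly_Mapping.keys p" for A
    using that
  proof (induction A rule: finite_induct)
    case (insert m A)
    then have "m \<in> Poly_Mapping.keys p" "A \<subseteq> Poly_Mapping.keys p" by blast+
    from S.a_closed[OF *[OF this(1)] insert.IH[OF this(2)]] insert.hyps show ?case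
      by (simp only: sum.insert laurent_ring_simps(3) not_False_eq_True)
  qed simp
  from this[of "Poly_Mapping.keys p"] show "phi_hat p \<in> carrier (laurent_ring P)"
    by (simp only: phi_hat_def phi_mon_def finite_keys order_refl)
qed (simp_all only: phi_hat_add phi_hat_mult phi_hat_1 poly_ring_simps laurent_ring_simps)

end

theory Submission
  imports Defs
begin

text \<open>
  Call a monomial standard if no underlined monomial divides it. Each binomial lies in the ideal
  and its second monomial is the smaller one, so the smallest monomial of every fibre of the
  monomial map is standard, and it suffices that a fibre contains only one standard monomial:
  then the leading monomial of an element of the ideal, being larger than another monomial of
  its fibre, is not standard.

  In a standard monomial the filters of each sign form a multichain; let \<open>f\<close> and \<open>g\<close> count the
  filters of \<open>P\<^sub>+\<close> and \<open>P\<^sub>-\<close> containing a given element. Each multichain is recovered from its size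
  and its counting function, while the image only records \<open>f - g\<close>. If \<open>(f, g) \<noteq> (f', g')\<close> belong
  to one fibre, let \<open>a\<close> be the first element, in a common linear extension, at which they differ,
  say \<open>f a > f' a\<close> and hence \<open>g a > g' a\<close>. For \<open>b\<close> strictly below \<open>a\<close> in \<open>P\<^sub>+\<close> we get
  \<open>f b = f' b \<le> f' a < f a\<close>, so \<open>a\<close> is minimal in the smallest filter of its multichain that contains
  it; the same happens in \<open>P\<^sub>-\<close>, and the two filters form a forbidden pair.
\<close>

section \<open>Multichains of sets\<close>

text \<open>A multichain is encoded by its multiplicities \<open>u\<close>; only the support must be
  totally ordered by inclusion. For a monomial, \<open>u\<close> is the exponent function on the
  variables of one sign.\<close>

definition chain_supp :: "'a set set \<Rightarrow> ('a set \<Rightarrow> nat) \<Rightarrow> bool" where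
  "chain_supp B u \<longleftrightarrow> (\<forall>G\<in>B. \<forall>H\<in>B. u G > 0 \<longrightarrow> u H > 0 \<longrightarrow> G \<subseteq> H \<or> H \<subseteq> G)"

text \<open>The counting functions \<open>f\<close> and \<open>g\<close> of the overview, with
  multiplicities counted.\<close>

definition height :: "'a set set \<Rightarrow> ('a set \<Rightarrow> nat) \<Rightarrow> 'a \<Rightarrow> nat" where
  "height B u x = (\<Sum>G\<in>{G\<in>B. x \<in> G}. u G)"

text \<open>If some member of the support does not contain \<open>F\<close>, let \<open>G\<close> be
  the largest such member and pick \<open>x\<close> in \<open>F\<close> outside \<open>G\<close>. A
  member through \<open>x\<close> cannot lie inside \<open>G\<close>, so it contains
  \<open>F\<close>: containing \<open>x\<close> and containing \<open>F\<close> are then the same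
  condition on the support.\<close>

lemma sum_superset_attained:
  assumes "finite B" and "chain_supp B u"
  shows "(\<Sum>G\<in>{G\<in>B. F \<subseteq> G}. u G) = (\<Sum>G\<in>B. u G) \<or>
         (\<exists>x\<in>F. (\<Sum>G\<in>{G\<in>B. F \<subseteq> G}. u G) = height B u x)"
proof (cases "\<exists>G\<in>B. u G > 0 \<and> \<not> F \<subseteq> G")
  case False
  then have "(\<Sum>G\<in>{G\<in>B. F \<subseteq> G}. u G) = (\<Sum>G\<in>B. u G)"
    by (intro sum.mono_neutral_left) (use assms in auto)
  then show ?thesis by simp
next
  case True
  let ?S = "{G\<in>B. u G > 0 \<and> \<not> F \<subseteq> G}"
  have "finite ?S" "?S \<noteq> {}" using assms True by auto
  then obtain G where G: "G \<in> ?S" and max: "\<forall>H\<in>?S. G \<le> H \<longrightarrow> G = H"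
    using finite_has_maximal[of ?S] by blast
  then obtain x where x: "x \<in> F" "x \<notin> G" by blast
  have above: "F \<subseteq> H" if "H \<in> B" "x \<in> H" "u H > 0" for H
  proof (rule ccontr)
    assume "\<not> F \<subseteq> H"
    then have "H \<in> ?S" using that by simp
    moreover have "G \<subseteq> H \<or> H \<subseteq> G" using assms(2) that G unfolding chain_supp_def by auto
    ultimately show False using max x that by blast
  qed
  have "(\<Sum>G\<in>{G\<in>B. F \<subseteq> G}. u G) = height B u x"
    unfolding height_def by (intro sum.mono_neutral_left) (use assms x above in auto)
  then show ?thesis using x by blast
qed

text \<open>By the previous lemma, the number of members of the multichain containing \<open>F\<close> is the minimum
  of its size and the heights of the elements of \<open>F\<close>.\<close>

lemma chain_multiplicity_le:
  assumes "finite B" "chain_supp B v" "F \<in> B"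
    and total: "sum u B = sum v B"
    and height: "\<And>x. x \<in> F \<Longrightarrow> height B u x = height B v x"
    and above: "\<And>G. G \<in> B \<Longrightarrow> F \<subset> G \<Longrightarrow> u G = v G"
  shows "u F \<le> v F"
proof -
  let ?T = "\<lambda>u. \<Sum>G\<in>{G\<in>B. F \<subseteq> G}. u G :: nat"
  have le1: "?T u \<le> sum u B"
    using assms(1) by (intro sum_mono2) auto
  have le2: "?T u \<le> height B u x" if "x \<in> F" for x
    unfolding height_def using assms(1) that by (intro sum_mono2) auto
  \<comment> \<open>\<open>v\<close> attains one of the bounds that \<open>u\<close> obeys, and
    these bounds have the same values for both.\<close>
  have "?T u \<le> ?T v"
    using sum_superset_attained[OF assms(1,2), of F] le1 le2 total height by force
  moreover have "?T w = w F + (\<Sum>G\<in>{G\<in>B. F \<subset> G}. w G)" for w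
  proof -
    have "{G\<in>B. F \<subseteq> G} = insert F {G\<in>B. F \<subset> G}" using assms(3) by auto
    then show ?thesis using assms(1) by simp
  qed
  moreover have "(\<Sum>G\<in>{G\<in>B. F \<subset> G}. u G) = (\<Sum>G\<in>{G\<in>B. F \<subset> G}. v G)"
    by (rule sum.cong) (use above in auto)
  ultimately show ?thesis by simp
qed

text \<open>Descending induction along inclusion: at a maximal set where the multiplicities differ,
  all larger sets agree, so \<open>chain_multiplicity_le\<close> applies in both directions.\<close>

lemma chain_determined_by_height:
  assumes "finite B" "chain_supp B u" "chain_supp B v"
    and "sum u B = sum v B"
    and "\<And>F x. F \<in> B \<Longrightarrow> x \<in> F \<Longrightarrow> height B u x = height B v x"
    and "F \<in> B"
  shows "u F = v F"
proof (rule ccontr)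
  let ?S = "{F\<in>B. u F \<noteq> v F}"
  assume "u F \<noteq> v F"
  then have "finite ?S" "?S \<noteq> {}" using assms by auto
  then obtain G where G: "G \<in> ?S" and max: "\<forall>H\<in>?S. G \<le> H \<longrightarrow> G = H"
    using finite_has_maximal[of ?S] by blast
  have above: "u H = v H" if "H \<in> B" "G \<subset> H" for H
    using max that by blast
  have "u G \<le> v G"
    by (rule chain_multiplicity_le[of B]) (use assms G above in auto)
  moreover have "v G \<le> u G"
    by (rule chain_multiplicity_le[of B]) (use assms G above in \<open>auto simp: eq_commute\<close>)
  ultimately show False using G by simp
qed

section \<open>Heights and minimal elements in chains of filters\<close>

lemma height_mono:
  assumes "finite P" "a \<in> P" "(b, a) \<in> r"
  shows "height (poset_filters P r) u b \<le> height (poset_filters P r) u a"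
  unfolding height_def
  by (rule sum_mono2) (use assms in \<open>auto simp: poset_filters_def\<close>)

lemma finite_poset_filters: "finite P \<Longrightarrow> finite (poset_filters P r)"
  by (rule finite_subset[of _ "Pow P"]) (auto simp: poset_filters_def)

text \<open>Supplies, for one sign, the filter of the forbidden pair: the smallest member of the
  support of \<open>u\<close> that contains \<open>a\<close>.\<close>

lemma minimal_in_chain:
  assumes "finite P" "a \<in> P" and chain: "chain_supp (poset_filters P r) u"
    and less: "height (poset_filters P r) v a < height (poset_filters P r) u a"
    and below: "\<And>b. b \<in> P \<Longrightarrow> (b, a) \<in> r \<Longrightarrow> b \<noteq> a \<Longrightarrow>
      height (poset_filters P r) u b = height (poset_filters P r) v b"
  obtains F where "F \<in> poset_filters P r" "u F > 0" "a \<in> minimal_elements r F"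
proof -
  let ?B = "poset_filters P r"
  let ?S = "{F\<in>?B. u F > 0 \<and> a \<in> F}"
  have fin: "finite ?B" using assms by (simp add: finite_poset_filters)
  have "?S \<noteq> {}"
  proof
    assume "?S = {}"
    then have "height ?B u a = 0" unfolding height_def using fin by auto
    then show False using less by simp
  qed
  then obtain F where F: "F \<in> ?S" and min: "\<forall>H\<in>?S. H \<le> F \<longrightarrow> F = H"
    using finite_has_minimal[of ?S] fin by auto
  have sub: "F \<subseteq> G" if "G \<in> ?S" for G
  proof -
    have "F \<subseteq> G \<or> G \<subseteq> F" using that F chain unfolding chain_supp_def by auto
    then show ?thesis using min that by blast
  qed
  have "a \<in> minimal_elements r F"
  proof (rule ccontr)
    assume "\<not> a \<in> minimal_elements r F"
    then obtain y where y: "y \<in> F" "(y, a) \<in> r" "y \<noteq> a"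
      using F by (auto simp: minimal_elements_def)
    have "y \<in> P" using y F by (auto simp: poset_filters_def)
    \<comment> \<open>Every member of the support through \<open>a\<close> contains \<open>F\<close>
      and hence \<open>y\<close>, so the height of \<open>u\<close> does not drop from
      \<open>a\<close> to \<open>y\<close>. At \<open>y\<close> it equals that of \<open>v\<close>,
      which is at most the height of \<open>v\<close> at \<open>a\<close>.\<close>
    have "height ?B u a = (\<Sum>G\<in>?S. u G)"
      unfolding height_def by (rule sum.mono_neutral_right) (use fin in auto)
    also have "\<dots> \<le> height ?B u y"
      unfolding height_def by (rule sum_mono2) (use fin y sub in auto)
    also have "\<dots> = height ?B v y" using below \<open>y \<in> P\<close> y by simp
    also have "\<dots> \<le> height ?B v a" using assms y by (intro height_mono)
    finally show False using less by simp
  qed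
  then show thesis using that F by blast
qed

text \<open>Serves both the common linear extension on \<open>P\<close> and the order
  \<open>L\<close> on the variables.\<close>

lemma linear_order_minimal:
  assumes "linear_order_on P l" "finite P" "D \<subseteq> P" "D \<noteq> {}"
  shows "\<exists>a\<in>D. \<forall>b\<in>D. (b, a) \<in> l \<longrightarrow> b = a"
proof -
  let ?R = "\<lambda>x y. (x, y) \<in> l \<and> x \<noteq> y"
  have "antisym l" "trans l" using assms(1) by (auto simp: order_on_defs)
  then have "asymp_on D ?R" "transp_on D ?R"
    by (auto simp: asymp_on_def transp_on_def antisym_def trans_def)
  moreover have "finite D" using assms finite_subset by blast
  ultimately have "\<exists>a\<in>D. \<forall>b\<in>D. b \<noteq> a \<longrightarrow> \<not> ?R b a"
    using assms(4) by (intro Finite_Set.bex_min_element)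
  then show ?thesis by blast
qed


section \<open>Monomial images\<close>

text \<open>The exponent vector of the Laurent monomial \<open>phi_var v\<close>, as
  \<open>phi_var_eq\<close> confirms.\<close>

definition expo :: "'a filter_var \<Rightarrow> (sign \<Rightarrow>\<^sub>0 nat) \<times> ('a \<Rightarrow>\<^sub>0 int)" where
  "expo v = (Poly_Mapping.single (fst v) 1,
     \<Sum>a\<in>snd v. Poly_Mapping.single a (if fst v = Plus then 1 else -1))"

text \<open>The fibres of the monomial map are the level sets of this function. Multiples of
  \<open>expo v\<close> are written as repeated sums so that they match powers through
  \<open>prod_single_one\<close>.\<close>

definition mon_expo :: "('a filter_var \<Rightarrow>\<^sub>0 nat) \<Rightarrow> (sign \<Rightarrow>\<^sub>0 nat) \<times> ('a \<Rightarrow>\<^sub>0 int)" where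
  "mon_expo m = (\<Sum>v\<in>Poly_Mapping.keys m. \<Sum>i<Poly_Mapping.lookup m v. expo v)"

lemma prod_single_one:
  "(\<Prod>a\<in>A. Poly_Mapping.single (f a) (1::'c::comm_semiring_1)) = Poly_Mapping.single (sum f A) 1"
  by (induction A rule: infinite_finite_induct) (auto simp: mult_single)

lemma prod_s_var:
  "(\<Prod>a\<in>F. s_var a) = Poly_Mapping.single (0, \<Sum>a\<in>F. Poly_Mapping.single a 1) 1"
  "(\<Prod>a\<in>F. s_inv a) = Poly_Mapping.single (0, \<Sum>a\<in>F. Poly_Mapping.single a (-1)) 1"
  unfolding s_var_def s_inv_def prod_single_one
  by (auto simp: prod_eq_iff fst_sum snd_sum intro!: arg_cong2[where f = Poly_Mapping.single])

lemma phi_var_eq: "phi_var v = Poly_Mapping.single (expo v) 1"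
  by (cases v rule: phi_var.cases) (simp_all add: t_var_def prod_s_var mult_single expo_def)

text \<open>Variables go to Laurent monomials with coefficient 1, hence so do all monomials; kernel
  questions thereby reduce to fibres of exponent vectors.\<close>

lemma phi_mon_eq: "phi_mon m = Poly_Mapping.single (mon_expo m) 1"
proof -
  have "phi_var v ^ n = Poly_Mapping.single (\<Sum>i<n. expo v) 1" for v :: "'a filter_var" and n
    using prod_single_one[of "\<lambda>_. expo v" "{..<n}", where 'c = complex] by (simp add: phi_var_eq)
  then show ?thesis by (simp add: phi_mon_def prod_single_one mon_expo_def)
qed

text \<open>Inherited from the multiplicativity of \<open>phi_mon\<close> by comparing the keys of
  two single terms.\<close>

lemma mon_expo_add: "mon_expo (m + n) = mon_expo m + mon_expo n"
proof -
  have "Poly_Mapping.single (mon_expo (m + n)) (1::complex) =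
        Poly_Mapping.single (mon_expo m + mon_expo n) 1"
    using phi_mon_add[of m n] by (simp add: phi_mon_eq mult_single)
  then show ?thesis by (metis keys_single singleton_inject zero_neq_one)
qed

lemma mon_expo_single: "mon_expo (Poly_Mapping.single v 1) = expo v"
  by (simp add: mon_expo_def)

lemma lookup_phi_hat:
  "Poly_Mapping.lookup (phi_hat p) e =
     (\<Sum>m\<in>{m\<in>Poly_Mapping.keys p. mon_expo m = e}. Poly_Mapping.lookup p m)"
proof -
  have "phi_hat p = (\<Sum>m\<in>Poly_Mapping.keys p.
          Poly_Mapping.single (mon_expo m) (Poly_Mapping.lookup p m))"
    by (subst phi_hat_superset[of "Poly_Mapping.keys p"]) (auto simp: phi_mon_eq mult_single)
  then show ?thesis
    by (simp add: lookup_sum lookup_single when_def sum.If_cases Int_def)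
qed

text \<open>If \<open>m\<close> were alone in its fibre, nothing could cancel its nonzero
  coefficient in the image.\<close>

lemma kernel_has_fibre_partner:
  assumes "phi_hat p = 0" "m \<in> Poly_Mapping.keys p"
  obtains n where "n \<in> Poly_Mapping.keys p" "n \<noteq> m" "mon_expo n = mon_expo m"
proof (rule ccontr)
  assume "\<not> thesis"
  then have "{n\<in>Poly_Mapping.keys p. mon_expo n = mon_expo m} = {m}"
    using assms that by auto
  then have "Poly_Mapping.lookup (phi_hat p) (mon_expo m) = Poly_Mapping.lookup p m"
    by (simp add: lookup_phi_hat)
  then show False using assms by (simp add: in_keys_iff)
qed

lemma UNIV_sign: "UNIV = {Plus, Minus}"
  using sign.exhaust by auto

lemma sum_signed_vars:
  assumes "\<And>\<sigma>. finite (B \<sigma>)"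
  shows "(\<Sum>v\<in>Sigma UNIV B. f v) = (\<Sum>F\<in>B Plus. f (Plus, F)) + (\<Sum>F\<in>B Minus. f (Minus, F))"
proof -
  have "(\<Sum>v\<in>Sigma UNIV B. f v) = (\<Sum>\<sigma>\<in>UNIV. \<Sum>F\<in>B \<sigma>. f (\<sigma>, F))"
    by (subst sum.Sigma) (use assms in \<open>auto simp: UNIV_sign\<close>)
  then show ?thesis by (simp add: UNIV_sign)
qed

lemma mon_expo_superset:
  assumes "finite V" "Poly_Mapping.keys m \<subseteq> V"
  shows "mon_expo m = (\<Sum>v\<in>V. \<Sum>i<Poly_Mapping.lookup m v. expo v)"
  unfolding mon_expo_def
  by (rule sum.mono_neutral_left) (use assms in \<open>auto simp: in_keys_iff\<close>)

text \<open>Each variable carries one factor \<open>t_var\<close> of its sign, so the image records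
  the size of each multichain.\<close>

lemma lookup_fst_mon_expo:
  assumes "\<And>\<sigma>. finite (B \<sigma>)" "Poly_Mapping.keys m \<subseteq> Sigma UNIV B"
  shows "Poly_Mapping.lookup (fst (mon_expo m)) \<sigma> = (\<Sum>F\<in>B \<sigma>. Poly_Mapping.lookup m (\<sigma>, F))"
proof -
  have "finite (Sigma UNIV B)" using assms by (auto simp: UNIV_sign)
  then show ?thesis
    using assms
    by (cases \<sigma>) (simp_all add: mon_expo_superset[of "Sigma UNIV B"] fst_sum lookup_sum expo_def
        sum_signed_vars lookup_single lookup_add)
qed

lemma lookup_snd_expo:
  assumes "finite F"
  shows "Poly_Mapping.lookup (snd (expo (\<sigma>, F))) a =
    (if a \<in> F then if \<sigma> = Plus then 1 else -1 else 0)"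
  using assms by (simp add: expo_def lookup_sum lookup_single when_def)

text \<open>A filter contributes 1 or -1, according to its sign, at each of its elements, so the
  image sees only the difference of the two heights.\<close>

lemma lookup_snd_mon_expo:
  assumes "\<And>\<sigma>. finite (B \<sigma>)" "\<And>\<sigma> F. F \<in> B \<sigma> \<Longrightarrow> finite F" "Poly_Mapping.keys m \<subseteq> Sigma UNIV B"
  shows "Poly_Mapping.lookup (snd (mon_expo m)) a =
    int (height (B Plus) (\<lambda>F. Poly_Mapping.lookup m (Plus, F)) a) -
    int (height (B Minus) (\<lambda>F. Poly_Mapping.lookup m (Minus, F)) a)"
proof -
  have "finite (Sigma UNIV B)" using assms by (auto simp: UNIV_sign)
  then have "Poly_Mapping.lookup (snd (mon_expo m)) a =
     (\<Sum>F\<in>B Plus. int (Poly_Mapping.lookup m (Plus, F)) * Poly_Mapping.lookup (snd (expo (Plus, F))) a) +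
     (\<Sum>F\<in>B Minus. int (Poly_Mapping.lookup m (Minus, F)) * Poly_Mapping.lookup (snd (expo (Minus, F))) a)"
    using assms by (simp add: mon_expo_superset[of "Sigma UNIV B"] snd_sum lookup_sum sum_signed_vars lookup_add)
  moreover have "(\<Sum>F\<in>B \<sigma>. int (Poly_Mapping.lookup m (\<sigma>, F)) * Poly_Mapping.lookup (snd (expo (\<sigma>, F))) a) =
     (if \<sigma> = Plus then 1 else -1) * int (height (B \<sigma>) (\<lambda>F. Poly_Mapping.lookup m (\<sigma>, F)) a)" for \<sigma>
  proof -
    have "(\<Sum>F\<in>B \<sigma>. int (Poly_Mapping.lookup m (\<sigma>, F)) * Poly_Mapping.lookup (snd (expo (\<sigma>, F))) a) =
      (\<Sum>F\<in>B \<sigma>. if a \<in> F then (if \<sigma> = Plus then 1 else -1) * int (Poly_Mapping.lookup m (\<sigma>, F)) else 0)"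
      by (rule sum.cong) (use assms in \<open>auto simp: lookup_snd_expo\<close>)
    also have "\<dots> = (if \<sigma> = Plus then 1 else -1) * int (height (B \<sigma>) (\<lambda>F. Poly_Mapping.lookup m (\<sigma>, F)) a)"
      unfolding height_def of_nat_sum sum_distrib_left
      by (rule sum.inter_filter[symmetric]) (use assms in auto)
    finally show ?thesis .
  qed
  ultimately show ?thesis by simp
qed


section \<open>The reverse lexicographic order\<close>

lemma mdeg_superset:
  assumes "finite A" "Poly_Mapping.keys m \<subseteq> A"
  shows "mdeg m = (\<Sum>v\<in>A. Poly_Mapping.lookup m v)"
  unfolding mdeg_def by (rule sum.mono_neutral_left) (use assms in \<open>auto simp: in_keys_iff\<close>)

lemma mdeg_add: "mdeg (m + n) = mdeg m + mdeg n"
proof -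
  let ?A = "Poly_Mapping.keys m \<union> Poly_Mapping.keys n"
  show ?thesis
    using Poly_Mapping.keys_add[of m n]
    by (simp add: mdeg_superset[of ?A] lookup_add sum.distrib)
qed

lemma mdeg_single [simp]: "mdeg (Poly_Mapping.single v n) = n"
  by (simp add: mdeg_def)

lemma revlex_less_add: "revlex_less L m n \<Longrightarrow> revlex_less L (m + r) (n + r)"
  by (auto simp: revlex_less_def mdeg_add lookup_add)

lemma revlex_less_mdeg: "revlex_less L m n \<Longrightarrow> mdeg m \<le> mdeg n"
  unfolding revlex_less_def by linarith

text \<open>In equal degree, let \<open>v\<close> and \<open>w\<close> decide the two given
  comparisons; the one that is smaller in \<open>L\<close> decides the comparison of
  \<open>m\<close> with \<open>k\<close>.\<close>

lemma revlex_less_trans: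
  assumes L: "linear_order_on V L"
    and V: "Poly_Mapping.keys m \<subseteq> V" "Poly_Mapping.keys n \<subseteq> V" "Poly_Mapping.keys k \<subseteq> V"
    and less: "revlex_less L m n" "revlex_less L n k"
  shows "revlex_less L m k"
proof (cases "mdeg m = mdeg n \<and> mdeg n = mdeg k")
  case False
  then have "mdeg m < mdeg k"
    using less[THEN revlex_less_mdeg] by linarith
  then show ?thesis by (simp add: revlex_less_def)
next
  case True
  then have mn: "\<not> mdeg m < mdeg n" and nk: "\<not> mdeg n < mdeg k" by simp_all
  from mn less(1) obtain v where v: "Poly_Mapping.lookup m v > Poly_Mapping.lookup n v"
      "\<And>u. (u, v) \<in> L \<Longrightarrow> u \<noteq> v \<Longrightarrow> Poly_Mapping.lookup m u = Poly_Mapping.lookup n u"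
    unfolding revlex_less_def by blast
  from nk less(2) obtain w where w: "Poly_Mapping.lookup n w > Poly_Mapping.lookup k w"
      "\<And>u. (u, w) \<in> L \<Longrightarrow> u \<noteq> w \<Longrightarrow> Poly_Mapping.lookup n u = Poly_Mapping.lookup k u"
    unfolding revlex_less_def by blast
  \<comment> \<open>A strictly larger exponent is positive, so both variables occur in a monomial
    over \<open>V\<close>, where \<open>L\<close> is total.\<close>
  have "v \<in> V" "w \<in> V" using v(1) w(1) V by (auto simp: subset_iff in_keys_iff)
  moreover have tr: "trans L" and as: "antisym L" and "total_on V L"
    using L by (auto simp: order_on_defs)
  ultimately consider "v = w" | "v \<noteq> w" "(v, w) \<in> L" | "v \<noteq> w" "(w, v) \<in> L"
    by (auto simp: total_on_def)
  then have "\<exists>v. Poly_Mapping.lookup m v > Poly_Mapping.lookup k v \<and>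
     (\<forall>u. (u, v) \<in> L \<and> u \<noteq> v \<longrightarrow> Poly_Mapping.lookup m u = Poly_Mapping.lookup k u)"
  proof cases
    case 1
    then have "Poly_Mapping.lookup m v > Poly_Mapping.lookup k v" using v(1) w(1) by simp
    moreover have "Poly_Mapping.lookup m u = Poly_Mapping.lookup k u" if "(u, v) \<in> L" "u \<noteq> v" for u
      using v(2)[OF that] w(2)[of u] that 1 by simp
    ultimately show ?thesis by blast
  next
    case 2
    have "Poly_Mapping.lookup m u = Poly_Mapping.lookup k u" if u: "(u, v) \<in> L" "u \<noteq> v" for u
    proof -
      have "(u, w) \<in> L" using u 2 transD[OF tr] by blast
      moreover have "u \<noteq> w" using u 2 antisymD[OF as] by blast
      ultimately show ?thesis using v(2)[OF u] w(2)[of u] by simp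
    qed
    moreover have "Poly_Mapping.lookup m v > Poly_Mapping.lookup k v"
      using v(1) w(2)[of v] 2 by simp
    ultimately show ?thesis by blast
  next
    case 3
    have "Poly_Mapping.lookup m u = Poly_Mapping.lookup k u" if u: "(u, w) \<in> L" "u \<noteq> w" for u
    proof -
      have "(u, v) \<in> L" using u 3 transD[OF tr] by blast
      moreover have "u \<noteq> v" using u 3 antisymD[OF as] by blast
      ultimately show ?thesis using v(2)[of u] w(2)[OF u] by simp
    qed
    moreover have "Poly_Mapping.lookup m w > Poly_Mapping.lookup k w"
      using v(2)[of w] w(1) 3 by simp
    ultimately show ?thesis by blast
  qed
  then show ?thesis using True by (simp add: revlex_less_def)
qed

lemma revlex_less_irrefl: "\<not> revlex_less L m m"
  by (simp add: revlex_less_def)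

text \<open>In equal degree the \<open>L\<close>-smallest variable with differing exponents
  decides.\<close>

lemma revlex_less_total:
  assumes L: "linear_order_on V L" "finite V"
    and V: "Poly_Mapping.keys m \<subseteq> V" "Poly_Mapping.keys n \<subseteq> V" and "m \<noteq> n"
  shows "revlex_less L m n \<or> revlex_less L n m"
proof (cases "mdeg m = mdeg n")
  case False
  then show ?thesis by (auto simp: revlex_less_def)
next
  case deg: True
  let ?D = "{v. Poly_Mapping.lookup m v \<noteq> Poly_Mapping.lookup n v}"
  have "?D \<subseteq> Poly_Mapping.keys m \<union> Poly_Mapping.keys n" by (auto simp: in_keys_iff)
  then have D: "?D \<subseteq> V" using V by blast
  have "?D \<noteq> {}" using \<open>m \<noteq> n\<close> poly_mapping_eqI[of m n] by blast
  from linear_order_minimal[OF L D this]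
  obtain v where v: "v \<in> ?D" "\<forall>u\<in>?D. (u, v) \<in> L \<longrightarrow> u = v" by blast
  then have below: "\<forall>u. (u, v) \<in> L \<and> u \<noteq> v \<longrightarrow> Poly_Mapping.lookup m u = Poly_Mapping.lookup n u"
    by blast
  consider "Poly_Mapping.lookup m v < Poly_Mapping.lookup n v" | "Poly_Mapping.lookup n v < Poly_Mapping.lookup m v"
    using v(1) by (auto simp: neq_iff)
  then show ?thesis
  proof cases
    case 1
    then have "\<exists>v. Poly_Mapping.lookup n v > Poly_Mapping.lookup m v \<and>
       (\<forall>u. (u, v) \<in> L \<and> u \<noteq> v \<longrightarrow> Poly_Mapping.lookup n u = Poly_Mapping.lookup m u)"
      using below by (intro exI[of _ v]) simp
    then show ?thesis using deg unfolding revlex_less_def by simp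
  next
    case 2
    then have "\<exists>v. Poly_Mapping.lookup m v > Poly_Mapping.lookup n v \<and>
       (\<forall>u. (u, v) \<in> L \<and> u \<noteq> v \<longrightarrow> Poly_Mapping.lookup m u = Poly_Mapping.lookup n u)"
      using below by blast
    then show ?thesis using deg unfolding revlex_less_def by simp
  qed
qed

lemma revlex_order:
  assumes "linear_order_on V L" "\<forall>m\<in>M. Poly_Mapping.keys m \<subseteq> V"
  shows "asymp_on M (revlex_less L)" "transp_on M (revlex_less L)"
proof -
  show "asymp_on M (revlex_less L)"
  proof (rule asymp_onI)
    fix m n assume "m \<in> M" "n \<in> M" "revlex_less L m n"
    then show "\<not> revlex_less L n m"
      using revlex_less_trans[OF assms(1), of m n m] assms(2) revlex_less_irrefl[of L m] by blast
  qed
  show "transp_on M (revlex_less L)"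
  proof (rule transp_onI)
    fix m n k assume "m \<in> M" "n \<in> M" "k \<in> M" "revlex_less L m n" "revlex_less L n k"
    then show "revlex_less L m k"
      using revlex_less_trans[OF assms(1), of m n k] assms(2) by blast
  qed
qed

section \<open>Leading monomials\<close>

lemma leading_monomial_eqI:
  assumes "linear_order_on V L" "\<forall>m\<in>Poly_Mapping.keys p. Poly_Mapping.keys m \<subseteq> V"
    and "m \<in> Poly_Mapping.keys p" "\<forall>n\<in>Poly_Mapping.keys p. n \<noteq> m \<longrightarrow> revlex_less L n m"
  shows "leading_monomial L p = m"
  unfolding leading_monomial_def
proof (rule the_equality)
  fix n
  assume n: "n \<in> Poly_Mapping.keys p \<and> (\<forall>k\<in>Poly_Mapping.keys p. k \<noteq> n \<longrightarrow> revlex_less L k n)"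
  show "n = m"
  proof (rule ccontr)
    assume "n \<noteq> m"
    then have "revlex_less L n m" "revlex_less L m n" using n assms(3,4) by simp_all
    then show False
      using asymp_onD[OF revlex_order(1)[OF assms(1,2)], of n m] n assms(3) by simp
  qed
qed (use assms(3,4) in simp)

text \<open>A maximal key exists by finiteness, and totality makes it the greatest one.\<close>

lemma leading_monomial_props:
  assumes "linear_order_on V L" "finite V" "\<forall>m\<in>Poly_Mapping.keys p. Poly_Mapping.keys m \<subseteq> V" "p \<noteq> 0"
  shows "leading_monomial L p \<in> Poly_Mapping.keys p"
    and "\<forall>n\<in>Poly_Mapping.keys p. n \<noteq> leading_monomial L p \<longrightarrow>
           revlex_less L n (leading_monomial L p)"
proof -
  have "\<exists>m\<in>Poly_Mapping.keys p. \<forall>n\<in>Poly_Mapping.keys p. n \<noteq> m \<longrightarrow> \<not> revlex_less L m n"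
    by (rule Finite_Set.bex_max_element[OF _ revlex_order[OF assms(1,3)]]) (use assms(4) in simp_all)
  then obtain m where m: "m \<in> Poly_Mapping.keys p" "\<forall>n\<in>Poly_Mapping.keys p. n \<noteq> m \<longrightarrow> \<not> revlex_less L m n"
    by blast
  then have less: "\<forall>n\<in>Poly_Mapping.keys p. n \<noteq> m \<longrightarrow> revlex_less L n m"
    using revlex_less_total[OF assms(1,2)] assms(3) by blast
  have "leading_monomial L p = m"
    by (rule leading_monomial_eqI[OF assms(1,3) m(1) less])
  then show "leading_monomial L p \<in> Poly_Mapping.keys p"
    and "\<forall>n\<in>Poly_Mapping.keys p. n \<noteq> leading_monomial L p \<longrightarrow>
           revlex_less L n (leading_monomial L p)"
    using m(1) less by simp_all
qed

text \<open>Exponents are at most \<open>d\<close> on \<open>V\<close> and vanish outside it, so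
  \<open>lookup\<close> embeds these monomials into a finite set of functions. This later gives
  fibres a smallest monomial.\<close>

lemma finite_monomials_mdeg:
  assumes "finite V"
  shows "finite {m. Poly_Mapping.keys m \<subseteq> V \<and> mdeg m = d}"
proof (rule inj_on_finite)
  show "inj_on Poly_Mapping.lookup {m. Poly_Mapping.keys m \<subseteq> V \<and> mdeg m = d}"
    by (rule inj_onI) (rule poly_mapping_eqI, simp)
  show "Poly_Mapping.lookup ` {m. Poly_Mapping.keys m \<subseteq> V \<and> mdeg m = d} \<subseteq>
      {f. \<forall>x. (x \<in> V \<longrightarrow> f x \<in> {..d}) \<and> (x \<notin> V \<longrightarrow> f x = 0)}"
  proof (intro image_subsetI CollectI allI conjI impI)
    fix m x assume m: "m \<in> {m. Poly_Mapping.keys m \<subseteq> V \<and> mdeg m = d}"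
    show "Poly_Mapping.lookup m x \<in> {..d}" if "x \<in> V"
      using m member_le_sum[OF that, of "Poly_Mapping.lookup m"] mdeg_superset[OF assms, of m] assms
      by simp
    show "Poly_Mapping.lookup m x = 0" if "x \<notin> V"
      using m that in_keys_iff[of x m] by blast
  qed
  show "finite {f. \<forall>x. (x \<in> V \<longrightarrow> f x \<in> {..d}) \<and> (x \<notin> V \<longrightarrow> f x = (0::nat))}"
    using assms by (intro finite_set_of_finite_funs) simp_all
qed

lemma leading_term_binomial:
  assumes "linear_order_on V L" "Poly_Mapping.keys m \<subseteq> V" "Poly_Mapping.keys n \<subseteq> V" "revlex_less L n m"
  shows "leading_term L (Poly_Mapping.single m 1 - Poly_Mapping.single n 1) = Poly_Mapping.single m 1"
    and "Poly_Mapping.single m 1 - Poly_Mapping.single n (1::complex) \<noteq> 0"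
proof -
  let ?p = "Poly_Mapping.single m 1 - Poly_Mapping.single n (1::complex)"
  have "m \<noteq> n" using assms(4) revlex_less_irrefl by blast
  then have m: "Poly_Mapping.lookup ?p m = 1"
    by (simp add: lookup_minus lookup_single)
  then show "?p \<noteq> 0" by (metis lookup_zero zero_neq_one)
  have keys: "Poly_Mapping.keys ?p \<subseteq> {m, n}"
    using keys_diff[of "Poly_Mapping.single m 1" "Poly_Mapping.single n (1::complex)"] by auto
  have "leading_monomial L ?p = m"
    by (rule leading_monomial_eqI[OF assms(1)]) (use keys m assms in \<open>auto simp: in_keys_iff\<close>)
  then show "leading_term L ?p = Poly_Mapping.single m 1"
    using m by (simp add: leading_term_def)
qed

section \<open>The quadratic binomials\<close>

abbreviation pair_mon :: "'v \<Rightarrow> 'v \<Rightarrow> ('v \<Rightarrow>\<^sub>0 nat)" where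
  "pair_mon u v \<equiv> Poly_Mapping.single u 1 + Poly_Mapping.single v 1"

text \<open>The binomials as pairs of exponent vectors, the underlined monomial first, so that
  divisibility and order are treated without coefficients.\<close>

definition binomial_pairs ::
    "'a set \<Rightarrow> (sign \<Rightarrow> 'a rel) \<Rightarrow> (('a filter_var \<Rightarrow>\<^sub>0 nat) \<times> ('a filter_var \<Rightarrow>\<^sub>0 nat)) set" where
  "binomial_pairs P ple =
     {(pair_mon (\<sigma>, F) (\<sigma>, F'), pair_mon (\<sigma>, F \<union> F') (\<sigma>, F \<inter> F')) | \<sigma> F F'.
        F \<in> poset_filters P (ple \<sigma>) \<and> F' \<in> poset_filters P (ple \<sigma>) \<and> \<not> F \<subseteq> F' \<and> \<not> F' \<subseteq> F} \<union>
     {(pair_mon (Plus, F) (Minus, F'), pair_mon (Plus, F - A) (Minus, F' - A)) | F F' A.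
        F \<in> poset_filters P (ple Plus) \<and> F' \<in> poset_filters P (ple Minus) \<and>
        A = minimal_elements (ple Plus) F \<inter> minimal_elements (ple Minus) F' \<and> A \<noteq> {}}"

lemma binomial_pairs_cases:
  assumes "(m, n) \<in> binomial_pairs P ple"
  obtains (same) \<sigma> F F' where "m = pair_mon (\<sigma>, F) (\<sigma>, F')"
      "n = pair_mon (\<sigma>, F \<union> F') (\<sigma>, F \<inter> F')"
      "F \<in> poset_filters P (ple \<sigma>)" "F' \<in> poset_filters P (ple \<sigma>)" "\<not> F \<subseteq> F'" "\<not> F' \<subseteq> F"
    | (mixed) F F' A where "m = pair_mon (Plus, F) (Minus, F')"
      "n = pair_mon (Plus, F - A) (Minus, F' - A)"
      "F \<in> poset_filters P (ple Plus)" "F' \<in> poset_filters P (ple Minus)"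
      "A = minimal_elements (ple Plus) F \<inter> minimal_elements (ple Minus) F'" "A \<noteq> {}"
  using assms unfolding binomial_pairs_def Un_iff mem_Collect_eq prod.inject
  by (elim disjE exE conjE) ((rule same; assumption) | (rule mixed; assumption))+

lemma binomial_pairs_same:
  assumes "F \<in> poset_filters P (ple \<sigma>)" "F' \<in> poset_filters P (ple \<sigma>)" "\<not> F \<subseteq> F'" "\<not> F' \<subseteq> F"
  shows "(pair_mon (\<sigma>, F) (\<sigma>, F'), pair_mon (\<sigma>, F \<union> F') (\<sigma>, F \<inter> F')) \<in> binomial_pairs P ple"
  unfolding binomial_pairs_def
  by (rule UnI1, rule CollectI, intro exI[of _ \<sigma>] exI[of _ F] exI[of _ F'] conjI refl assms)

lemma binomial_pairs_mixed:
  assumes "F \<in> poset_filters P (ple Plus)" "F' \<in> poset_filters P (ple Minus)"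
    "A = minimal_elements (ple Plus) F \<inter> minimal_elements (ple Minus) F'" "A \<noteq> {}"
  shows "(pair_mon (Plus, F) (Minus, F'), pair_mon (Plus, F - A) (Minus, F' - A)) \<in> binomial_pairs P ple"
  unfolding binomial_pairs_def
  by (rule UnI2, rule CollectI, intro exI[of _ F] exI[of _ F'] exI[of _ A] conjI refl assms)

lemma X_mult_X: "X u * X v = Poly_Mapping.single (pair_mon u v) 1"
  by (simp add: X_def mult_single)

lemma binomials_eq:
  "same_sign_binomials P ple \<union> mixed_sign_binomials P ple =
     (\<lambda>(m, n). Poly_Mapping.single m 1 - Poly_Mapping.single n 1) ` binomial_pairs P ple"
    (is "?G = ?f ` _")
proof
  show "?G \<subseteq> ?f ` binomial_pairs P ple"
  proof
    fix p assume "p \<in> ?G"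
    then consider "p \<in> same_sign_binomials P ple" | "p \<in> mixed_sign_binomials P ple" by blast
    then show "p \<in> ?f ` binomial_pairs P ple"
    proof cases
      case 1
      then obtain \<sigma> F F' where p: "p = X (\<sigma>, F) * X (\<sigma>, F') - X (\<sigma>, F \<union> F') * X (\<sigma>, F \<inter> F')"
        and F: "F \<in> poset_filters P (ple \<sigma>)" "F' \<in> poset_filters P (ple \<sigma>)" "\<not> F \<subseteq> F'" "\<not> F' \<subseteq> F"
        unfolding same_sign_binomials_def by blast
      show ?thesis
        by (rule image_eqI[OF _ binomial_pairs_same[of F P ple \<sigma> F', OF F]]) (simp only: p X_mult_X prod.case)
    next
      case 2
      then obtain F F' A where p: "p = X (Plus, F) * X (Minus, F') - X (Plus, F - A) * X (Minus, F' - A)"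
        and F: "F \<in> poset_filters P (ple Plus)" "F' \<in> poset_filters P (ple Minus)"
          "A = minimal_elements (ple Plus) F \<inter> minimal_elements (ple Minus) F'" "A \<noteq> {}"
        unfolding mixed_sign_binomials_def by blast
      show ?thesis
        by (rule image_eqI[OF _ binomial_pairs_mixed[OF F]]) (simp only: p X_mult_X prod.case)
    qed
  qed
  show "?f ` binomial_pairs P ple \<subseteq> ?G"
  proof (rule image_subsetI)
    fix mn assume mn: "mn \<in> binomial_pairs P ple"
    obtain m n where eq: "mn = (m, n)" by (cases mn)
    from mn[unfolded eq] show "?f mn \<in> ?G"
    proof (cases rule: binomial_pairs_cases)
      case (same \<sigma> F F')
      show ?thesis
        unfolding eq prod.case same_sign_binomials_def X_mult_X same(1,2)
        by (rule UnI1, rule CollectI, intro exI[of _ \<sigma>] exI[of _ F] exI[of _ F'] conjI refl same(3-6))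
    next
      case (mixed F F' A)
      show ?thesis
        unfolding eq prod.case mixed_sign_binomials_def X_mult_X mixed(1,2)
        by (rule UnI2, rule CollectI, intro exI[of _ F] exI[of _ F'] exI[of _ A] conjI refl mixed(3-6))
    qed
  qed
qed

lemma keys_pair_mon: "Poly_Mapping.keys (pair_mon u v) = {u, v}"
  by (auto simp: in_keys_iff lookup_add lookup_single when_def split: if_splits)

text \<open>\<open>w\<close> is the smallest variable involved and divides only the first monomial;
  in a reverse lexicographic order that makes the first monomial the smaller one.\<close>

lemma revlex_less_pair_mon:
  assumes "(w, z) \<in> L" "(w, u) \<in> L" "(w, v) \<in> L" "u \<noteq> w" "v \<noteq> w" "antisym L"
  shows "revlex_less L (pair_mon w z) (pair_mon u v)"
proof -
  have "Poly_Mapping.lookup (pair_mon w z) x = Poly_Mapping.lookup (pair_mon u v) x"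
    if "(x, w) \<in> L" "x \<noteq> w" for x
  proof -
    have "x \<noteq> z" "x \<noteq> u" "x \<noteq> v" using that assms antisymD[OF assms(6)] by blast+
    then show ?thesis using that by (simp add: lookup_add lookup_single)
  qed
  moreover have "Poly_Mapping.lookup (pair_mon w z) w > Poly_Mapping.lookup (pair_mon u v) w"
    using assms by (simp add: lookup_add lookup_single)
  moreover have "mdeg (pair_mon w z) = mdeg (pair_mon u v)"
    by (simp only: mdeg_add mdeg_single)
  ultimately show ?thesis
    unfolding revlex_less_def by blast
qed

lemma pair_mon_divides:
  assumes "u \<in> Poly_Mapping.keys m" "v \<in> Poly_Mapping.keys m" "u \<noteq> v"
  obtains r where "m = pair_mon u v + r"
proof
  have "Poly_Mapping.lookup m u > 0" "Poly_Mapping.lookup m v > 0"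
    using assms(1,2) by (simp_all add: in_keys_iff)
  \<comment> \<open>Since \<open>u\<close> and \<open>v\<close> differ and both have positive
    exponent, the natural-number subtraction truncates nothing.\<close>
  then show "m = pair_mon u v + (m - pair_mon u v)"
    using assms(3)
    by (intro poly_mapping_eqI) (auto simp: lookup_add lookup_minus lookup_single when_def)
qed

text \<open>For the third claim: an element of \<open>F\<close> below a removed minimal element
  equals it, so upward closure survives the removal.\<close>

lemma poset_filters_closed:
  assumes "F \<in> poset_filters P r"
  shows "G \<in> poset_filters P r \<Longrightarrow> F \<union> G \<in> poset_filters P r"
    and "G \<in> poset_filters P r \<Longrightarrow> F \<inter> G \<in> poset_filters P r"
    and "A \<subseteq> minimal_elements r F \<Longrightarrow> F - A \<in> poset_filters P r"
  using assms unfolding poset_filters_def minimal_elements_def by blast+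

lemma expo_union_inter:
  assumes "finite F" "finite G"
  shows "expo (\<sigma>, F \<union> G) + expo (\<sigma>, F \<inter> G) = expo (\<sigma>, F) + expo (\<sigma>, G)"
  using assms by (simp add: expo_def sum.union_inter)

text \<open>The factors \<open>s_var a\<close> with \<open>a\<close> in \<open>A\<close> cancel
  against the factors \<open>s_inv a\<close>.\<close>

lemma expo_diff_diff:
  assumes "finite F" "finite G" "A \<subseteq> F" "A \<subseteq> G"
  shows "expo (Plus, F - A) + expo (Minus, G - A) = expo (Plus, F) + expo (Minus, G)"
proof -
  let ?s = "\<lambda>a. Poly_Mapping.single a (1::int)"
  have "(\<Sum>a\<in>F. ?s a) = (\<Sum>a\<in>F - A. ?s a) + (\<Sum>a\<in>A. ?s a)"
       "(\<Sum>a\<in>G. ?s a) = (\<Sum>a\<in>G - A. ?s a) + (\<Sum>a\<in>A. ?s a)"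
    using assms by (auto intro: sum.subset_diff)
  then show ?thesis
    by (simp add: expo_def single_uminus sum_negf)
qed

lemma mon_expo_pair_mon: "mon_expo (pair_mon u v) = expo u + expo v"
  by (simp add: mon_expo_add mon_expo_single del: One_nat_def)

section \<open>The binomials under an admissible order\<close>

locale admissible_double_poset =
  fixes P :: "'a set" and ple :: "sign \<Rightarrow> 'a rel" and L :: "'a filter_var rel"
  assumes double_poset: "double_poset P ple"
    and admissible: "admissible_order P ple L"
begin

abbreviation V where "V \<equiv> filter_vars P ple"
abbreviation B where "B \<sigma> \<equiv> poset_filters P (ple \<sigma>)"

lemma finite_P: "finite P"
  using double_poset by (simp add: double_poset_def)

lemma finite_B: "finite (B \<sigma>)"
  using finite_P by (rule finite_poset_filters)

lemma finite_mem_B: "F \<in> B \<sigma> \<Longrightarrow> finite F"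
  using finite_P finite_subset by (auto simp: poset_filters_def)

lemma V_eq: "V = Sigma UNIV B"
  by (simp add: filter_vars_def)

lemma finite_V: "finite V"
  using finite_B by (auto simp: V_eq UNIV_sign)

lemma linear_L: "linear_order_on V L"
  using admissible by (simp add: admissible_order_def)

lemma antisym_L: "antisym L"
  using linear_L by (simp add: order_on_defs)

lemma L_subset: "F \<in> B \<sigma> \<Longrightarrow> F' \<in> B \<sigma> \<Longrightarrow> F \<subseteq> F' \<Longrightarrow> F \<noteq> F' \<Longrightarrow> ((\<sigma>, F), (\<sigma>, F')) \<in> L"
  using admissible unfolding admissible_order_def by blast

lemma L_Plus_Minus: "F \<in> B Plus \<Longrightarrow> F' \<in> B Minus \<Longrightarrow> ((Plus, F), (Minus, F')) \<in> L"
  using admissible unfolding admissible_order_def by blast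

lemma binomial_pairs_props:
  assumes "(m, n) \<in> binomial_pairs P ple"
  shows "Poly_Mapping.keys m \<subseteq> V" "Poly_Mapping.keys n \<subseteq> V" "revlex_less L n m"
    "mon_expo n = mon_expo m"
proof -
  from assms have "Poly_Mapping.keys m \<subseteq> V \<and> Poly_Mapping.keys n \<subseteq> V \<and> revlex_less L n m \<and>
    mon_expo n = mon_expo m"
  proof (cases rule: binomial_pairs_cases)
    case (same \<sigma> F F')
    note in_B = same(3,4) poset_filters_closed(1,2)[OF same(3,4)]
    \<comment> \<open>The smallest variable is put first: by incomparability the intersection is
      strictly contained in \<open>F\<close>, in \<open>F'\<close> and in their union.\<close>
    have "n = pair_mon (\<sigma>, F \<inter> F') (\<sigma>, F \<union> F')" using same(2) by (simp add: add.commute)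
    moreover have "revlex_less L (pair_mon (\<sigma>, F \<inter> F') (\<sigma>, F \<union> F')) (pair_mon (\<sigma>, F) (\<sigma>, F'))"
      by (rule revlex_less_pair_mon) (use in_B same(5,6) antisym_L in \<open>auto intro!: L_subset\<close>)
    moreover have "mon_expo n = mon_expo m"
      unfolding same(1,2) mon_expo_pair_mon
      using same(3,4) by (intro expo_union_inter finite_mem_B)
    ultimately show ?thesis
      using in_B unfolding same(1) by (auto simp only: keys_pair_mon V_eq)
  next
    case (mixed F F' A)
    have A: "A \<subseteq> minimal_elements (ple Plus) F" "A \<subseteq> minimal_elements (ple Minus) F'"
      using mixed by auto
    then have AF: "A \<subseteq> F" "A \<subseteq> F'" by (auto simp: minimal_elements_def)
    note in_B = mixed(3,4) poset_filters_closed(3)[OF mixed(3) A(1)] poset_filters_closed(3)[OF mixed(4) A(2)]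
    \<comment> \<open>As \<open>A\<close> is nonempty, \<open>(Plus, F - A)\<close> is strictly
      below \<open>(Plus, F)\<close>; it also precedes every variable of sign \<open>Minus\<close>,
      so it is the deciding one.\<close>
    have ne: "F - A \<noteq> F" using AF mixed(6) by blast
    have "revlex_less L n m"
      unfolding mixed(1,2)
      by (rule revlex_less_pair_mon) (use in_B ne antisym_L in \<open>auto intro!: L_subset L_Plus_Minus\<close>)
    moreover have "mon_expo n = mon_expo m"
      unfolding mixed(1,2) mon_expo_pair_mon
      using mixed(3,4) AF by (intro expo_diff_diff finite_mem_B)
    ultimately show ?thesis
      using in_B unfolding mixed(1,2) by (auto simp only: keys_pair_mon V_eq)
  qed
  then show "Poly_Mapping.keys m \<subseteq> V" "Poly_Mapping.keys n \<subseteq> V" "revlex_less L n m"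
    "mon_expo n = mon_expo m" by simp_all
qed


section \<open>Standard monomials\<close>

text \<open>Divisibility is stated with a cofactor \<open>r\<close>, so that \<open>h + r\<close> is
  at hand as a smaller monomial of the same fibre.\<close>

definition standard :: "('a filter_var \<Rightarrow>\<^sub>0 nat) \<Rightarrow> bool" where
  "standard m \<longleftrightarrow> Poly_Mapping.keys m \<subseteq> V \<and>
     (\<forall>g h r. (g, h) \<in> binomial_pairs P ple \<longrightarrow> m \<noteq> g + r)"

text \<open>Two incomparable filters in the support would give a divisor that leads a binomial of
  one sign.\<close>

lemma standard_chain:
  assumes "standard m"
  shows "chain_supp (B \<sigma>) (\<lambda>F. Poly_Mapping.lookup m (\<sigma>, F))"
proof -
  have "F \<subseteq> F' \<or> F' \<subseteq> F" if F: "F \<in> B \<sigma>" "F' \<in> B \<sigma>"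
    and pos: "Poly_Mapping.lookup m (\<sigma>, F) > 0" "Poly_Mapping.lookup m (\<sigma>, F') > 0" for F F'
  proof (rule ccontr)
    assume inc: "\<not> (F \<subseteq> F' \<or> F' \<subseteq> F)"
    have "(\<sigma>, F) \<in> Poly_Mapping.keys m" "(\<sigma>, F') \<in> Poly_Mapping.keys m" "(\<sigma>, F) \<noteq> (\<sigma>, F')"
      using pos inc by (auto simp: in_keys_iff)
    then obtain r where "m = pair_mon (\<sigma>, F) (\<sigma>, F') + r" by (rule pair_mon_divides)
    moreover have "(pair_mon (\<sigma>, F) (\<sigma>, F'), pair_mon (\<sigma>, F \<union> F') (\<sigma>, F \<inter> F')) \<in> binomial_pairs P ple"
      using F inc by (intro binomial_pairs_same) simp_all
    ultimately show False using assms unfolding standard_def by blast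
  qed
  then show ?thesis unfolding chain_supp_def by blast
qed

lemma standard_minimal_disjoint:
  assumes "standard m" "F \<in> B Plus" "F' \<in> B Minus"
    and pos: "Poly_Mapping.lookup m (Plus, F) > 0" "Poly_Mapping.lookup m (Minus, F') > 0"
  shows "minimal_elements (ple Plus) F \<inter> minimal_elements (ple Minus) F' = {}"
proof (rule ccontr)
  let ?A = "minimal_elements (ple Plus) F \<inter> minimal_elements (ple Minus) F'"
  assume ne: "?A \<noteq> {}"
  have "(Plus, F) \<in> Poly_Mapping.keys m" "(Minus, F') \<in> Poly_Mapping.keys m" "(Plus, F) \<noteq> (Minus, F')"
    using pos by (auto simp: in_keys_iff)
  then obtain r where "m = pair_mon (Plus, F) (Minus, F') + r" by (rule pair_mon_divides)
  moreover have "(pair_mon (Plus, F) (Minus, F'), pair_mon (Plus, F - ?A) (Minus, F' - ?A))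
      \<in> binomial_pairs P ple"
    using assms(2,3) ne by (intro binomial_pairs_mixed) simp_all
  ultimately show False using assms(1) unfolding standard_def by blast
qed

abbreviation mheight where
  "mheight m \<sigma> \<equiv> height (B \<sigma>) (\<lambda>F. Poly_Mapping.lookup m (\<sigma>, F))"

lemma mheight_diff:
  assumes "standard m" "standard n" "mon_expo m = mon_expo n"
  shows "int (mheight m Plus a) - int (mheight m Minus a) =
         int (mheight n Plus a) - int (mheight n Minus a)"
proof -
  have "Poly_Mapping.lookup (snd (mon_expo k)) a =
      int (mheight k Plus a) - int (mheight k Minus a)" if "standard k" for k
    using that finite_B finite_mem_B
    by (intro lookup_snd_mon_expo) (auto simp: standard_def V_eq)
  from this[OF assms(1)] this[OF assms(2)] show ?thesis using assms(3) by simp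
qed

text \<open>By \<open>mheight_diff\<close> an excess at \<open>a\<close> for \<open>Plus\<close> is
  also one for \<open>Minus\<close>. Then \<open>minimal_in_chain\<close> yields a filter of each
  sign with \<open>a\<close> minimal in both, against \<open>standard_minimal_disjoint\<close>. The
  one-sided form allows \<open>m\<close> and \<open>n\<close> to be exchanged.\<close>

lemma standard_height_not_less:
  assumes "standard m" "standard n" "mon_expo m = mon_expo n" "a \<in> P"
    and below: "\<And>b \<sigma>. b \<in> P \<Longrightarrow> (b, a) \<in> ple \<sigma> \<Longrightarrow> b \<noteq> a \<Longrightarrow> mheight m \<sigma> b = mheight n \<sigma> b"
  shows "\<not> mheight n Plus a < mheight m Plus a"
proof
  assume less: "mheight n Plus a < mheight m Plus a"
  then have "mheight n Minus a < mheight m Minus a"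
    using mheight_diff[OF assms(1-3), of a] by linarith
  with less have less: "mheight n \<sigma> a < mheight m \<sigma> a" for \<sigma> by (cases \<sigma>) simp_all
  have "\<exists>F\<in>B \<sigma>. Poly_Mapping.lookup m (\<sigma>, F) > 0 \<and> a \<in> minimal_elements (ple \<sigma>) F" for \<sigma>
  proof -
    obtain F where "F \<in> B \<sigma>" "Poly_Mapping.lookup m (\<sigma>, F) > 0" "a \<in> minimal_elements (ple \<sigma>) F"
      using minimal_in_chain[OF finite_P assms(4) standard_chain[OF assms(1)] less below, of \<sigma>] by blast
    then show ?thesis by blast
  qed
  from this[of Plus] this[of Minus] show False
    using standard_minimal_disjoint[OF assms(1)] by blast
qed

lemma standard_height_unique:
  assumes "compatible P ple" "standard m" "standard n" "mon_expo m = mon_expo n" "a \<in> P"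
  shows "mheight m Plus a = mheight n Plus a \<and> mheight m Minus a = mheight n Minus a"
proof -
  obtain l where l: "linear_order_on P l" "ple Plus \<subseteq> l" "ple Minus \<subseteq> l"
    using assms(1) unfolding compatible_def by blast
  then have sub: "ple \<sigma> \<subseteq> l" for \<sigma> by (cases \<sigma>) simp_all
  let ?D = "{a\<in>P. mheight m Plus a \<noteq> mheight n Plus a}"
  have iff: "mheight m Plus b = mheight n Plus b \<longleftrightarrow> mheight m Minus b = mheight n Minus b" for b
    using mheight_diff[OF assms(2-4), of b] by linarith
  have "?D = {}"
  proof (rule ccontr)
    assume "?D \<noteq> {}"
    from linear_order_minimal[OF l(1) finite_P _ this]
    obtain b where b: "b \<in> ?D" and min: "\<forall>c\<in>?D. (c, b) \<in> l \<longrightarrow> c = b" by blast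
    \<comment> \<open>Here compatibility enters: an element below \<open>b\<close> in either partial
      order is below it in \<open>l\<close>, where no earlier difference occurs.\<close>
    have below: "mheight m \<sigma> c = mheight n \<sigma> c" if "c \<in> P" "(c, b) \<in> ple \<sigma>" "c \<noteq> b" for c \<sigma>
    proof -
      have "mheight m Plus c = mheight n Plus c" using min that sub by blast
      then show ?thesis using iff by (cases \<sigma>) simp_all
    qed
    have "\<not> mheight n Plus b < mheight m Plus b"
      using b by (intro standard_height_not_less[OF assms(2-4)] below) simp_all
    moreover have "\<not> mheight m Plus b < mheight n Plus b"
      using b by (intro standard_height_not_less[OF assms(3,2) assms(4)[symmetric]] below[symmetric]) simp_all
    ultimately show False using b by simp
  qed
  then show ?thesis using assms(5) iff by blast
qed

text \<open>Sizes agree by the exponents of the \<open>t\<close> variables and heights by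
  \<open>standard_height_unique\<close>; together they determine each multichain.\<close>

lemma standard_unique:
  assumes "compatible P ple" "standard m" "standard n" "mon_expo m = mon_expo n"
  shows "m = n"
proof (rule poly_mapping_eqI)
  fix v :: "'a filter_var"
  obtain \<sigma> F where v: "v = (\<sigma>, F)" by (cases v)
  show "Poly_Mapping.lookup m v = Poly_Mapping.lookup n v"
  proof (cases "F \<in> B \<sigma>")
    case False
    then have "v \<notin> V" by (simp add: v V_eq)
    then have "v \<notin> Poly_Mapping.keys m" "v \<notin> Poly_Mapping.keys n"
      using assms(2,3) unfolding standard_def by blast+
    then show ?thesis by (simp add: in_keys_iff)
  next
    case True
    have deg: "Poly_Mapping.lookup (fst (mon_expo k)) \<sigma> = (\<Sum>F\<in>B \<sigma>. Poly_Mapping.lookup k (\<sigma>, F))"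
      if "standard k" for k
      using that by (intro lookup_fst_mon_expo finite_B) (simp add: standard_def V_eq)
    have "mheight m \<sigma> x = mheight n \<sigma> x" if "x \<in> P" for x
      using standard_height_unique[OF assms that] by (cases \<sigma>) simp_all
    then have ht: "mheight m \<sigma> x = mheight n \<sigma> x" if "G \<in> B \<sigma>" "x \<in> G" for G x
      using that by (auto simp: poset_filters_def)
    show ?thesis
      unfolding v
      by (rule chain_determined_by_height[OF finite_B standard_chain[OF assms(2)]
            standard_chain[OF assms(3)] _ ht True])
         (use deg[OF assms(2)] deg[OF assms(3)] assms(4) in simp_all)
  qed
qed

section \<open>Smallest monomials of fibres\<close>

lemma mdeg_mon_expo:
  assumes "Poly_Mapping.keys m \<subseteq> V"
  shows "mdeg m = Poly_Mapping.lookup (fst (mon_expo m)) Plus + Poly_Mapping.lookup (fst (mon_expo m)) Minus"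
proof -
  have "Poly_Mapping.lookup (fst (mon_expo m)) \<sigma> = (\<Sum>F\<in>B \<sigma>. Poly_Mapping.lookup m (\<sigma>, F))" for \<sigma>
    using assms by (intro lookup_fst_mon_expo finite_B) (simp add: V_eq)
  moreover have "mdeg m = (\<Sum>v\<in>Sigma UNIV B. Poly_Mapping.lookup m v)"
    using mdeg_superset[OF finite_V assms] by (simp add: V_eq)
  ultimately show ?thesis by (simp add: sum_signed_vars[OF finite_B])
qed

text \<open>The fibre has a smallest monomial \<open>k\<close>, which is standard; by uniqueness it
  is \<open>m\<close>.\<close>

lemma standard_is_fibre_minimum:
  assumes "compatible P ple" "standard m"
    and n: "Poly_Mapping.keys n \<subseteq> V" "mon_expo n = mon_expo m"
  shows "\<not> revlex_less L n m"
proof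
  assume less: "revlex_less L n m"
  let ?M = "{k. Poly_Mapping.keys k \<subseteq> V \<and> mon_expo k = mon_expo m}"
  have m: "m \<in> ?M" using assms(2) by (simp add: standard_def)
  \<comment> \<open>The exponents of the \<open>t\<close> variables add up to the degree, so a fibre
    lies in a single degree.\<close>
  have "?M \<subseteq> {k. Poly_Mapping.keys k \<subseteq> V \<and> mdeg k = mdeg m}"
    using m by (auto simp: mdeg_mon_expo)
  then have fin: "finite ?M" using finite_monomials_mdeg[OF finite_V] by (rule finite_subset)
  have keys: "\<forall>k\<in>?M. Poly_Mapping.keys k \<subseteq> V" by blast
  have "\<exists>k\<in>?M. \<forall>k'\<in>?M. k' \<noteq> k \<longrightarrow> \<not> revlex_less L k' k"
    by (rule Finite_Set.bex_min_element[OF fin revlex_order[OF linear_L keys]]) (use m in blast)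
  then obtain k where k: "k \<in> ?M" and min: "\<forall>k'\<in>?M. k' \<noteq> k \<longrightarrow> \<not> revlex_less L k' k" by blast
  have "standard k"
    unfolding standard_def
  proof (intro conjI allI impI notI)
    show "Poly_Mapping.keys k \<subseteq> V" using k by blast
    fix g h r assume gh: "(g, h) \<in> binomial_pairs P ple" and kgr: "k = g + r"
    note gh = binomial_pairs_props[OF gh]
    have "Poly_Mapping.keys r \<subseteq> Poly_Mapping.keys k"
      unfolding kgr by (auto simp: in_keys_iff lookup_add)
    then have "Poly_Mapping.keys (h + r) \<subseteq> V"
      using gh(2) k Poly_Mapping.keys_add[of h r] by blast
    \<comment> \<open>Replacing the divisor \<open>g\<close> by \<open>h\<close> keeps the fibre and
      lowers the monomial, against the minimality of \<open>k\<close>.\<close>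
    moreover have "mon_expo (h + r) = mon_expo k" unfolding kgr using gh(4) by (simp add: mon_expo_add)
    ultimately have "h + r \<in> ?M" using k by simp
    moreover have "revlex_less L (h + r) k" unfolding kgr using gh(3) by (rule revlex_less_add)
    moreover from this have "h + r \<noteq> k" using revlex_less_irrefl by metis
    ultimately show False using min by blast
  qed
  then have "k = m" using standard_unique[OF assms(1)] assms(2) k by blast
  moreover have "n \<noteq> m" using less revlex_less_irrefl by blast
  ultimately show False using min n less by blast
qed

section \<open>The toric ideal and its leading terms\<close>

lemma toric_ideal_iff:
  "p \<in> toric_ideal P ple \<longleftrightarrow> (\<forall>m\<in>Poly_Mapping.keys p. Poly_Mapping.keys m \<subseteq> V) \<and> phi_hat p = 0"
  by (simp add: toric_ideal_def a_kernel_def')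

text \<open>A standard leading monomial would be smallest in its fibre, yet its partner from
  \<open>kernel_has_fibre_partner\<close> is another key of \<open>p\<close> and hence
  smaller.\<close>

lemma leading_monomial_divisible:
  assumes "compatible P ple" "p \<in> toric_ideal P ple" "p \<noteq> 0"
  obtains g h r where "(g, h) \<in> binomial_pairs P ple" "leading_monomial L p = g + r"
proof (rule ccontr)
  let ?m = "leading_monomial L p"
  assume "\<not> thesis"
  then have no: "(g, h) \<in> binomial_pairs P ple \<Longrightarrow> ?m \<noteq> g + r" for g h r using that by blast
  have V: "\<forall>m\<in>Poly_Mapping.keys p. Poly_Mapping.keys m \<subseteq> V" and ker: "phi_hat p = 0"
    using assms(2) by (simp_all add: toric_ideal_iff)
  note lm = leading_monomial_props[OF linear_L finite_V V assms(3)]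
  have "standard ?m" using V lm(1) no unfolding standard_def by blast
  moreover obtain n where "n \<in> Poly_Mapping.keys p" "n \<noteq> ?m" "mon_expo n = mon_expo ?m"
    using kernel_has_fibre_partner[OF ker lm(1)] .
  ultimately show False using standard_is_fibre_minimum[OF assms(1), of ?m n] V lm(2) by blast
qed

lemma binomial_in_toric_ideal:
  assumes "(m, n) \<in> binomial_pairs P ple"
  shows "Poly_Mapping.single m 1 - Poly_Mapping.single n 1 \<in> toric_ideal P ple"
proof -
  let ?p = "Poly_Mapping.single m 1 - Poly_Mapping.single n (1::complex)"
  note mn = binomial_pairs_props[OF assms]
  \<comment> \<open>The difference is handled through additivity, by adding its second monomial
    back.\<close>
  have "phi_hat ?p + phi_hat (Poly_Mapping.single n 1) = phi_hat (Poly_Mapping.single m 1)"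
    by (simp flip: phi_hat_add)
  moreover have "phi_hat (Poly_Mapping.single n 1) = phi_hat (Poly_Mapping.single m 1)"
    using mn(4) by (simp add: phi_hat_single phi_mon_eq)
  ultimately have "phi_hat ?p = 0" by simp
  moreover have "Poly_Mapping.keys ?p \<subseteq> {m, n}"
    using keys_diff[of "Poly_Mapping.single m 1" "Poly_Mapping.single n (1::complex)"] by auto
  ultimately show ?thesis using mn(1,2) unfolding toric_ideal_iff by blast
qed

lemma finite_binomial_pairs: "finite (binomial_pairs P ple)"
proof (rule finite_subset)
  let ?Q = "(\<lambda>(u, v). pair_mon u v) ` (V \<times> V)"
  show "finite (?Q \<times> ?Q)" using finite_V by simp
  have "m \<in> ?Q \<and> n \<in> ?Q" if "(m, n) \<in> binomial_pairs P ple" for m n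
  proof -
    note V = binomial_pairs_props(1,2)[OF that]
    have Q: "pair_mon u v \<in> ?Q" if "Poly_Mapping.keys (pair_mon u v) \<subseteq> V" for u v
      by (rule image_eqI[of _ _ "(u, v)"]) (use that[unfolded keys_pair_mon] in simp_all)
    from that show ?thesis
      by (cases rule: binomial_pairs_cases) (use V Q in blast)+
  qed
  then show "binomial_pairs P ple \<subseteq> ?Q \<times> ?Q" by (intro subrelI SigmaI) simp_all
qed

lemma leading_term_binomial_pair:
  assumes "(m, n) \<in> binomial_pairs P ple"
  shows "leading_term L (Poly_Mapping.single m 1 - Poly_Mapping.single n 1) = Poly_Mapping.single m 1"
    and "Poly_Mapping.single m 1 - Poly_Mapping.single n (1::complex) \<noteq> 0"
  using leading_term_binomial[OF linear_L binomial_pairs_props(1-3)[OF assms]] by simp_all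

text \<open>The substantial inclusion shows that every leading term from the toric ideal is a
  multiple of an underlined monomial; the other is monotonicity of generated ideals.\<close>

lemma groebner_basis_binomials:
  assumes "compatible P ple"
  shows "groebner_basis V L (toric_ideal P ple) (same_sign_binomials P ple \<union> mixed_sign_binomials P ple)"
proof -
  let ?G = "same_sign_binomials P ple \<union> mixed_sign_binomials P ple"
  let ?I = "toric_ideal P ple"
  interpret R: cring "poly_ring V" by (rule cring_poly_ring)
  have fin: "finite ?G" unfolding binomials_eq using finite_binomial_pairs by simp
  have sub: "?G \<subseteq> ?I" unfolding binomials_eq using binomial_in_toric_ideal by auto
  have lt_carr: "leading_term L ` (?I - {0}) \<subseteq> carrier (poly_ring V)"
  proof
    fix t assume "t \<in> leading_term L ` (?I - {0})"
    then obtain p where t: "t = leading_term L p" and p: "p \<in> ?I" "p \<noteq> 0" by blast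
    then have V: "\<forall>m\<in>Poly_Mapping.keys p. Poly_Mapping.keys m \<subseteq> V" by (simp add: toric_ideal_iff)
    then show "t \<in> carrier (poly_ring V)"
      using leading_monomial_props(1)[OF linear_L finite_V V p(2)] by (simp add: t leading_term_def)
  qed
  have G_carr: "leading_term L ` (?G - {0}) \<subseteq> carrier (poly_ring V)"
    using sub lt_carr by blast
  interpret J: ideal "Idl\<^bsub>poly_ring V\<^esub> (leading_term L ` (?G - {0}))" "poly_ring V"
    by (rule R.genideal_ideal[OF G_carr])
  have "leading_term L ` (?I - {0}) \<subseteq> Idl\<^bsub>poly_ring V\<^esub> (leading_term L ` (?G - {0}))"
  proof
    fix t assume t_in: "t \<in> leading_term L ` (?I - {0})"
    then obtain p where t: "t = leading_term L p" and p: "p \<in> ?I" "p \<noteq> 0" by blast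
    obtain g h r where gh: "(g, h) \<in> binomial_pairs P ple" and r: "leading_monomial L p = g + r"
      using leading_monomial_divisible[OF assms p] .
    let ?c = "Poly_Mapping.lookup p (leading_monomial L p)"
    let ?b = "Poly_Mapping.single g 1 - Poly_Mapping.single h (1::complex)"
    have "?b \<in> ?G"
      unfolding binomials_eq using gh by (rule rev_image_eqI) simp
    then have "?b \<in> ?G - {0}" using leading_term_binomial_pair(2)[OF gh] by simp
    then have "leading_term L ?b \<in> Idl\<^bsub>poly_ring V\<^esub> (leading_term L ` (?G - {0}))"
      using R.genideal_self[OF G_carr] by blast
    then have g_in: "Poly_Mapping.single g 1 \<in> Idl\<^bsub>poly_ring V\<^esub> (leading_term L ` (?G - {0}))"
      by (simp only: leading_term_binomial_pair(1)[OF gh])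
    have V: "\<forall>m\<in>Poly_Mapping.keys p. Poly_Mapping.keys m \<subseteq> V"
      using p(1) by (simp add: toric_ideal_iff)
    have "Poly_Mapping.keys r \<subseteq> Poly_Mapping.keys (g + r)"
      by (auto simp: in_keys_iff lookup_add)
    then have "Poly_Mapping.keys r \<subseteq> V"
      using V leading_monomial_props(1)[OF linear_L finite_V V p(2)] unfolding r by blast
    \<comment> \<open>This term, with the cofactor as exponent and the leading coefficient of
      \<open>p\<close>, multiplies the underlined monomial to \<open>t\<close>.\<close>
    then have "Poly_Mapping.single r ?c \<in> carrier (poly_ring V)" by simp
    from J.I_l_closed[OF g_in this]
    show "t \<in> Idl\<^bsub>poly_ring V\<^esub> (leading_term L ` (?G - {0}))"
      by (simp add: t leading_term_def r mult_single add.commute)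
  qed
  then have "Idl\<^bsub>poly_ring V\<^esub> (leading_term L ` (?I - {0})) \<subseteq>
      Idl\<^bsub>poly_ring V\<^esub> (leading_term L ` (?G - {0}))"
    by (rule R.genideal_minimal[OF J.ideal_axioms])
  moreover have "Idl\<^bsub>poly_ring V\<^esub> (leading_term L ` (?G - {0})) \<subseteq>
      Idl\<^bsub>poly_ring V\<^esub> (leading_term L ` (?I - {0}))"
    using sub by (intro R.subset_Idl_subset lt_carr) blast
  ultimately show ?thesis using fin sub unfolding groebner_basis_def by blast
qed

end

theorem theorem5p2:
  fixes P :: "'a set" and ple :: "sign \<Rightarrow> 'a rel" and L :: "'a filter_var rel"
  assumes "double_poset P ple"
    and "compatible P ple"
    and "admissible_order P ple L"
  shows "groebner_basis (filter_vars P ple) L (toric_ideal P ple)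
           (same_sign_binomials P ple \<union> mixed_sign_binomials P ple) \<and>
         (\<forall>\<sigma>. \<forall>F\<in>poset_filters P (ple \<sigma>). \<forall>F'\<in>poset_filters P (ple \<sigma>).
            \<not> F \<subseteq> F' \<and> \<not> F' \<subseteq> F \<longrightarrow>
            leading_term L (X (\<sigma>, F) * X (\<sigma>, F') - X (\<sigma>, F \<union> F') * X (\<sigma>, F \<inter> F'))
              = X (\<sigma>, F) * X (\<sigma>, F')) \<and>
         (\<forall>F\<in>poset_filters P (ple Plus). \<forall>F'\<in>poset_filters P (ple Minus). \<forall>A.
            A = minimal_elements (ple Plus) F \<inter> minimal_elements (ple Minus) F' \<and> A \<noteq> {} \<longrightarrow>
            leading_term L (X (Plus, F) * X (Minus, F') - X (Plus, F - A) * X (Minus, F' - A))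
              = X (Plus, F) * X (Minus, F'))"
proof -
  interpret admissible_double_poset P ple L
    using assms(1,3) by unfold_locales
  show ?thesis
    \<comment> \<open>With products of variables turned into single terms, the leading-term claims
      become instances of \<open>leading_term_binomial_pair\<close>.\<close>
    unfolding X_mult_X
    by (intro conjI allI ballI impI groebner_basis_binomials[OF assms(2)]
        leading_term_binomial_pair(1) binomial_pairs_same binomial_pairs_mixed) simp_all
qed

end
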